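(* Let $\mathcal{H}$ be a real Hilbert space with inner product $\langle\cdot,\cdot\rangle$ and norm $\|\cdot\|$. Let $\Phi:\mathcal{H}\to\mathbb{R}$ be a convex $C^1$ function such that $\arg\min\Phi=\{v\in\mathcal{H}:\Phi(v)=\Phi^*\}$ is nonempty, where $\Phi^*=\min_{x\in\mathcal{H}}\Phi(x)$. Let $c>0$, $\alpha\in[0,1)$, $\gamma(t)=\frac{c}{(1+t)^\alpha}$, and $g\in L^1(0,+\infty;\mathcal{H})$. Let $x\in W^{2,1}_{loc}(0,+\infty;\mathcal{H})$ be a solution of $$\ddot x(t)+\gamma(t)\dot x(t)+\nabla\Phi(x(t))=g(t),\quad t\ge 0.$$ Assume that $\int_0^{+\infty}(1+t)^\alpha\|g(t)\|\,dt<\infty$ and that the interior of $\arg\min\Phi$ is nonempty. Then there exists $x^*\in\arg\min\Phi$ such that $x(t)\to x^*$ strongly in $\mathcal{H}$ as $t\to+\infty$.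
   Context: $W^{2,1}_{loc}(0,+\infty;\mathcal{H})$ denotes functions whose first and second (weak) derivatives are locally integrable with values in $\mathcal{H}$; $\dot x,\ddot x$ denote the first and second time derivatives. *)

theory Defs
  imports "HOL-Analysis.Analysis"
begin

definition argmin_set :: "('a \<Rightarrow> real) \<Rightarrow> 'a set" where
  "argmin_set \<Phi> = {v. \<forall>y. \<Phi> v \<le> \<Phi> y}"

end

theory Submission
  imports Defs
begin

text \<open>
  Write the velocity as \<open>x' = q + R\<close>, where \<open>q\<close> solves the damped equation
  \<open>q' + \<gamma> q = - grad\<Phi> x\<close> and \<open>R\<close> absorbs the forcing term.  Because \<open>(1 + t)\<^sup>\<alpha> \<parallel>g\<parallel>\<close> is
  integrable, \<open>R\<close> is integrable and \<open>(1 + t)\<^sup>\<alpha> \<parallel>R t\<parallel>\<close> tends to 0.  As \<open>q\<close> is continuously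
  differentiable, the Lyapunov function
  \<open>(8/c) (1 + t)\<^bsup>2\<alpha>\<^esup> (\<parallel>q\<parallel>\<^sup>2/2 + \<Phi> x - \<Phi> v) + (1 + t)\<^sup>\<alpha> q \<bullet> (x - v) + (c - \<alpha> (1 + t)\<^bsup>\<alpha>-1\<^esup>) \<parallel>x - v\<parallel>\<^sup>2/2\<close>
  can be differentiated classically.  If \<open>v\<close> is the centre of a ball of radius \<open>r\<close> of minimizers, then
  \<open>grad\<Phi> x \<bullet> (x - v) \<ge> \<Phi> x - \<Phi> v + r \<parallel>grad\<Phi> x\<parallel>\<close>, and a Gronwall argument shows that
  \<open>(1 + t)\<^sup>\<alpha> \<parallel>grad\<Phi> x\<parallel>\<close> is integrable.  Applying the first step again, now with
  \<open>grad\<Phi> x\<close> as part of the forcing, makes \<open>x'\<close> integrable, so \<open>x\<close> converges, and the gradient vanishes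
  at the limit.
\<close>

section \<open>Monotonicity from one-sided local estimates\<close>

lemma right_locally_nonincreasing_imp_le:
  fixes f :: "real \<Rightarrow> real"
  assumes "a \<le> b" "continuous_on {a..b} f"
    and step: "\<And>t. a \<le> t \<Longrightarrow> t < b \<Longrightarrow> \<forall>\<^sub>F s in at_right t. f s \<le> f t"
  shows "f b \<le> f a"
proof -
  define T where "T = {t \<in> {a..b}. f t \<le> f a}"
  have "closed T"
    unfolding T_def using assms(2) by (intro continuous_on_closed_Collect_le) auto
  moreover have "{a..b} \<inter> T = T" by (auto simp: T_def)
  ultimately have "compact T" using compact_Int_closed[OF compact_Icc] by metis
  moreover have "a \<in> T" using assms(1) by (simp add: T_def)
  ultimately obtain u where u: "u \<in> T" "\<And>t. t \<in> T \<Longrightarrow> t \<le> u"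
    using compact_attains_sup[of T] by blast
  \<comment> \<open>\<open>T\<close> is compact, so it has a last point \<open>u\<close>. If
    \<open>u\<close> were less than \<open>b\<close>, the local estimate to the right of
    \<open>u\<close> would put a later point into \<open>T\<close>.\<close>
  have "u = b"
  proof (rule ccontr)
    assume "u \<noteq> b"
    then have ub: "a \<le> u" "u < b" using u by (auto simp: T_def)
    have "\<forall>\<^sub>F s in at_right u. s < b \<and> u < s"
      using ub(2) by (auto simp: eventually_at_right_field intro!: exI[of _ b])
    then have "\<forall>\<^sub>F s in at_right u. s < b \<and> u < s \<and> f s \<le> f u"
      using step[OF ub] by eventually_elim auto
    then obtain s where "s < b \<and> u < s \<and> f s \<le> f u"
      using eventually_happens'[OF trivial_limit_at_right_real] by fastforce
    then show False using u(2)[of s] u(1) ub by (auto simp: T_def)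
  qed
  then show ?thesis using u by (auto simp: T_def)
qed

text \<open>Subtracting a small multiple \<open>d * m\<close> makes the local estimate exact, and
  the total price \<open>d * (m b - m a)\<close> stays below any prescribed \<open>e\<close>. The
  function \<open>m\<close> measures the admissible error, so \<open>f\<close> may fail to be
  differentiable.\<close>

lemma right_nonincreasing_up_to_imp_le:
  fixes f m :: "real \<Rightarrow> real"
  assumes "a \<le> b" "continuous_on {a..b} f" "continuous_on {a..b} m"
    and step: "\<And>t e. a \<le> t \<Longrightarrow> t < b \<Longrightarrow> e > 0 \<Longrightarrow>
      \<forall>\<^sub>F s in at_right t. f s - f t \<le> e * (m s - m t)"
  shows "f b \<le> f a"
proof (rule field_le_epsilon)
  fix e :: real assume "e > 0"
  define d where "d = e / (\<bar>m b - m a\<bar> + 1)"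
  have "d > 0" using \<open>e > 0\<close> by (simp add: d_def add_pos_nonneg)
  have "f b - d * m b \<le> f a - d * m a"
  proof (rule right_locally_nonincreasing_imp_le[where f = "\<lambda>t. f t - d * m t"])
    show "\<forall>\<^sub>F s in at_right t. f s - d * m s \<le> f t - d * m t" if "a \<le> t" "t < b" for t
      using step[OF that \<open>d > 0\<close>] by eventually_elim (simp add: algebra_simps)
  qed (use assms in \<open>auto intro!: continuous_intros\<close>)
  then have "f b \<le> f a + d * (m b - m a)" by (simp add: algebra_simps)
  moreover have "d * (m b - m a) \<le> d * (\<bar>m b - m a\<bar> + 1)"
    using \<open>d > 0\<close> by (intro mult_left_mono) auto
  moreover have "d * (\<bar>m b - m a\<bar> + 1) = e" by (simp add: d_def)
  ultimately show "f b \<le> f a + e" by linarith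
qed

section \<open>Integrals tested against fixed vectors\<close>

lemma integral_diff_eq:
  fixes f :: "real \<Rightarrow> real"
  assumes "0 \<le> a" "a \<le> b" "f integrable_on {0..b}"
  shows "integral {0..b} f - integral {0..a} f = integral {a..b} f"
  using Henstock_Kurzweil_Integration.integral_combine[OF assms] by simp

lemma norm_le_if_inner_le:
  fixes v :: "'a::real_inner"
  assumes "\<And>w. \<bar>v \<bullet> w\<bar> \<le> C * norm w" "0 \<le> C"
  shows "norm v \<le> C"
proof (cases "v = 0")
  case False
  have "norm v * norm v \<le> C * norm v"
    using assms(1)[of v] by (simp add: power2_norm_eq_inner flip: power2_eq_square)
  with False show ?thesis by simp
qed (use assms in simp)

text \<open>The hypothesis is weak: \<open>v\<close> is the integral of \<open>f\<close> after
  pairing with each \<open>w\<close>. Cauchy-Schwarz bounds every pairing by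
  \<open>integral S k * norm w\<close>, and testing with \<open>v\<close> itself recovers the
  norm.\<close>

lemma norm_increment_le_integral:
  fixes v :: "'a::real_inner" and f :: "real \<Rightarrow> 'a"
  assumes "\<And>w. ((\<lambda>t. f t \<bullet> w) has_integral v \<bullet> w) S"
    and "k integrable_on S" "\<And>t. t \<in> S \<Longrightarrow> norm (f t) \<le> k t"
  shows "norm v \<le> integral S k"
proof (rule norm_le_if_inner_le)
  show "0 \<le> integral S k"
    by (rule integral_nonneg) (use assms in \<open>auto intro: order_trans[OF norm_ge_zero]\<close>)
  fix w
  have "norm (integral S (\<lambda>t. f t \<bullet> w)) \<le> integral S (\<lambda>t. k t * norm w)"
  proof (rule integral_norm_bound_integral)
    show "norm (f t \<bullet> w) \<le> k t * norm w" if "t \<in> S" for t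
      using order_trans[OF Cauchy_Schwarz_ineq2 mult_right_mono[OF assms(3)[OF that] norm_ge_zero]]
      by simp
  qed (use assms in \<open>auto intro: integrable_on_mult_left\<close>)
  then show "\<bar>v \<bullet> w\<bar> \<le> integral S k * norm w"
    using integral_unique[OF assms(1)[of w]] by simp
qed

lemma has_integral_inner_derivative:
  fixes F :: "real \<Rightarrow> 'a::real_inner"
  assumes "a \<le> b" "\<And>t. t \<in> {a..b} \<Longrightarrow> (F has_vector_derivative f t) (at t within {a..b})"
  shows "((\<lambda>t. f t \<bullet> w) has_integral (F b - F a) \<bullet> w) {a..b}"
  unfolding inner_diff_left
proof (rule fundamental_theorem_of_calculus[OF assms(1)])
  show "((\<lambda>t. F t \<bullet> w) has_vector_derivative f t \<bullet> w) (at t within {a..b})" if "t \<in> {a..b}" for t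
    by (rule bounded_linear.has_vector_derivative[OF bounded_linear_inner_left assms(2)[OF that]])
qed

section \<open>Primitives of continuous curves in a Hilbert space\<close>

lemma integral_has_vector_derivative_ray:
  fixes f :: "real \<Rightarrow> 'a::banach"
  assumes "continuous_on {0..} f" "0 \<le> t"
  shows "((\<lambda>u. integral {0..u} f) has_vector_derivative f t) (at t within {0..})"
proof -
  have "at t within {0..t+1} = at t within {0..}"
    by (rule at_within_nhd[of t "{..<t+1}"]) auto
  moreover have "((\<lambda>u. integral {0..u} f) has_vector_derivative f t) (at t within {0..t+1})"
    using assms by (intro integral_has_vector_derivative) (auto elim: continuous_on_subset)
  ultimately show ?thesis by simp
qed

text \<open>Vector integrals of continuous functions are only available for the class \<open>banach\<close>, of which
  the sort of the theorem is not a subsort.  So integrate in the dual space, where the Riesz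
  embedding has complete, hence closed, range containing all Riemann sums.\<close>

lemma continuous_imp_primitive:
  fixes f :: "real \<Rightarrow> 'a::{real_inner,complete_space}"
  assumes cont: "continuous_on {0..} f"
  obtains F where "\<And>t. t \<ge> 0 \<Longrightarrow> (F has_vector_derivative f t) (at t within {0..})"
proof -
  define J where "J = (blinfun_inner_right :: 'a \<Rightarrow> _)"
  have lin: "bounded_linear J" unfolding J_def by (rule bounded_linear_blinfun_inner_right)
  then interpret J: bounded_linear J .
  have normJ: "norm (J v) = norm v" for v
  proof (rule antisym)
    show "norm (J v) \<le> norm v"
      by (rule norm_blinfun_bound) (auto simp: J_def Cauchy_Schwarz_ineq2)
    show "norm v \<le> norm (J v)"
    proof (rule norm_le_if_inner_le)
      show "\<bar>v \<bullet> w\<bar> \<le> norm (J v) * norm w" for w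
        using norm_blinfun[of "J v" w] by (simp add: J_def)
    qed simp
  qed
  have "complete (J ` UNIV)"
    by (rule complete_isometric_image[of 1]) (auto simp: lin normJ complete_UNIV)
  then have closed: "closed (range J)" by (rule complete_imp_closed)
  have Jcont: "continuous_on {0..t} (\<lambda>s. J (f s))" for t
    using cont by (intro J.continuous_on) (auto elim: continuous_on_subset)
  define I where "I t = integral {0..t} (\<lambda>s. J (f s))" for t
  have I_range: "I t \<in> range J" for t
  proof -
    have "\<exists>y\<in>range J. dist y (I t) < e" if "e > 0" for e
    proof -
      have "((\<lambda>s. J (f s)) has_integral I t) (cbox 0 t)"
        using integrable_continuous_interval[OF Jcont] by (simp add: I_def integrable_integral)
      from this[unfolded has_integral, rule_format, OF \<open>e > 0\<close>]
      obtain d where "gauge d" and d: "\<And>D. D tagged_division_of cbox 0 t \<Longrightarrow> d fine D \<Longrightarrow>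
          norm ((\<Sum>(x,k)\<in>D. measure lborel k *\<^sub>R J (f x)) - I t) < e"
        by metis
      obtain D where D: "D tagged_division_of cbox 0 t" "d fine D"
        using fine_division_exists[OF \<open>gauge d\<close>] by blast
      have "(\<Sum>(x,k)\<in>D. measure lborel k *\<^sub>R J (f x)) = J (\<Sum>(x,k)\<in>D. measure lborel k *\<^sub>R f x)"
        by (simp add: J.sum J.scaleR case_prod_unfold)
      then show ?thesis using d[OF D] by (auto simp: dist_norm)
    qed
    then show ?thesis using closed by (metis closed_approachable)
  qed
  define F where "F t = inv J (I t)" for t
  have JF: "J (F t) = I t" for t
    using I_range by (simp add: F_def f_inv_into_f)
  have "(F has_vector_derivative f t) (at t within {0..})" if "t \<ge> 0" for t
  proof -
    have "((\<lambda>s. J (F s)) has_vector_derivative J (f t)) (at t within {0..})"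
      unfolding JF I_def
      using J.continuous_on[OF cont] that by (rule integral_has_vector_derivative_ray)
    \<comment> \<open>Since \<open>J\<close> is a linear isometry, the first-order remainders of
      \<open>F\<close> and of its image under \<open>J\<close> have equal norm, so differentiability
      passes back through the embedding.\<close>
    moreover have "norm (J (F y) - J (F t) - (y - t) *\<^sub>R J (f t)) = norm (F y - F t - (y - t) *\<^sub>R f t)" for y
      by (simp add: normJ flip: J.diff J.scaleR)
    ultimately show ?thesis
      by (simp add: has_vector_derivative_def has_derivative_iff_norm bounded_linear_scaleR_left)
  qed
  then show thesis by (rule that)
qed

lemma eventually_at_right_derivative_bound:
  fixes F :: "real \<Rightarrow> 'a::real_normed_vector"
  assumes "(F has_vector_derivative D) (at t within {0..})" "0 \<le> t" "e > 0"
  shows "\<forall>\<^sub>F s in at_right t. norm (F s - F t - (s - t) *\<^sub>R D) \<le> e * (s - t)"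
proof -
  have "\<forall>\<^sub>F s in at t within {0..}. norm (F s - F t - (s - t) *\<^sub>R D) \<le> e * \<bar>s - t\<bar>"
    using assms(1,3) by (simp add: has_vector_derivative_def has_derivative_within_alt2)
  then have "\<forall>\<^sub>F s in at_right t. norm (F s - F t - (s - t) *\<^sub>R D) \<le> e * \<bar>s - t\<bar>"
    using assms(2) by (elim filter_leD[rotated]) (auto intro!: at_le)
  moreover have "\<forall>\<^sub>F s in at_right t. t < s" by (rule eventually_at_right_less)
  ultimately show ?thesis by eventually_elim simp
qed

section \<open>Decay estimates for the damped linear equation\<close>

locale damping =
  fixes c \<alpha> :: real
  assumes c_pos: "c > 0" and alpha_nonneg: "0 \<le> \<alpha>" and alpha_less_1: "\<alpha> < 1"
begin

lemma eventually_powr_small: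
  assumes "e > 0"
  shows "\<forall>\<^sub>F t::real in at_top. (1 + t) powr (\<alpha> - 1) \<le> e"
proof -
  have "((\<lambda>t::real. (1 + t) powr (\<alpha> - 1)) \<longlongrightarrow> 0) at_top"
    using alpha_less_1
    by (intro tendsto_neg_powr filterlim_tendsto_add_at_top[OF tendsto_const filterlim_ident]) auto
  then have "\<forall>\<^sub>F t::real in at_top. (1 + t) powr (\<alpha> - 1) < e"
    using assms by (rule order_tendstoD(2))
  then show ?thesis by eventually_elim simp
qed

lemma powr_ge_1: "0 \<le> t \<Longrightarrow> 1 \<le> (1 + t) powr \<alpha>"
  using alpha_nonneg by (simp add: ge_one_powr_ge_zero)

text \<open>
  In the next lemma, \<open>y\<close> satisfies \<open>y' + (c / (1 + t)\<^sup>\<alpha>) y = f\<close> with \<open>\<parallel>f\<parallel> \<le> k\<close>, in integrated form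
  (\<open>Y\<close> is a primitive of the damping term), since \<open>y\<close> need not be differentiable anywhere.
\<close>

lemma weighted_step:
  fixes y Y :: "real \<Rightarrow> 'b::real_normed_vector" and k :: "real \<Rightarrow> real"
  assumes cont: "continuous_on {0..} y"
    and Y: "\<And>t. t \<ge> 0 \<Longrightarrow> (Y has_vector_derivative (c / (1 + t) powr \<alpha>) *\<^sub>R y t) (at t within {0..})"
    and k_nonneg: "\<And>t. t \<ge> 0 \<Longrightarrow> 0 \<le> k t"
    and k_int: "\<And>T. k integrable_on {0..T}"
    and W_int: "\<And>T. (\<lambda>t. (1 + t) powr \<alpha> * k t) integrable_on {0..T}"
    and step: "\<And>a b. 0 \<le> a \<Longrightarrow> a \<le> b \<Longrightarrow> norm ((y b + Y b) - (y a + Y a)) \<le> integral {a..b} k"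
    and a: "0 \<le> a" "a \<le> b" and small: "\<And>t. a \<le> t \<Longrightarrow> \<alpha> * (1 + t) powr (\<alpha> - 1) \<le> c / 2"
  shows "(1 + b) powr \<alpha> * norm (y b) + c / 2 * integral {a..b} (\<lambda>t. norm (y t))
    \<le> (1 + a) powr \<alpha> * norm (y a) + integral {a..b} (\<lambda>t. (1 + t) powr \<alpha> * k t)"
proof -
  define W where "W t = (1 + t) powr \<alpha> * k t" for t
  define N where "N t = (1 + t) powr \<alpha> * norm (y t)" for t
  define I where "I t = integral {0..t} (\<lambda>t. norm (y t))" for t
  define D where "D t = integral {0..t} W" for t
  have ycont: "continuous_on {0..} (\<lambda>t. norm (y t))" using cont by (intro continuous_intros)
  have I': "(I has_vector_derivative norm (y t)) (at t within {0..})" if "t \<ge> 0" for t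
    unfolding I_def using ycont that by (rule integral_has_vector_derivative_ray)
  have Dcont: "continuous_on {a..b} D"
  proof -
    have "continuous_on {0..b} D"
      unfolding D_def W_def by (rule indefinite_integral_continuous_1[OF W_int])
    then show ?thesis by (rule continuous_on_subset) (use a in auto)
  qed
  have Icont: "continuous_on {a..b} I"
    by (rule continuous_on_vector_derivative, rule has_vector_derivative_within_subset[OF I'])
       (use a in auto)
  \<comment> \<open>In the error measure \<open>m\<close>, the linear part pays for the first-order
    remainders of \<open>w\<close> and \<open>I\<close>, and \<open>D\<close> pays for the growth of
    the weight between \<open>t\<close> and \<open>s\<close>.\<close>
  have "(N b + c/2 * I b - D b) \<le> N a + c/2 * I a - D a"
  proof (rule right_nonincreasing_up_to_imp_le[where m = "\<lambda>t. (1 + c/2) * t + D t"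
        and f = "\<lambda>t. N t + c/2 * I t - D t", OF a(2)])
    show "continuous_on {a..b} (\<lambda>t. N t + c/2 * I t - D t)"
      unfolding N_def using a
      by (intro continuous_intros Icont Dcont continuous_on_subset[OF cont]) auto
    show "continuous_on {a..b} (\<lambda>t. (1 + c/2) * t + D t)"
      by (intro continuous_intros Dcont)
    fix t e :: real assume t: "a \<le> t" "t < b" and e: "e > 0"
    then have t0: "0 \<le> t" using a by simp
    \<comment> \<open>\<open>w\<close> keeps only the damping increment after time \<open>t\<close>.
      It is differentiable at \<open>t\<close> even if \<open>y\<close> is not, and the discarded
      part is controlled by the integral of \<open>k\<close>.\<close>
    define w where "w s = (1 + s) powr \<alpha> *\<^sub>R (y t - (Y s - Y t))" for s
    define \<mu> where "\<mu> = c - \<alpha> * (1 + t) powr (\<alpha> - 1)"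
    have mu: "c / 2 \<le> \<mu>" "\<mu> \<le> c" using small[OF t(1)] alpha_nonneg by (auto simp: \<mu>_def)
    have "(w has_vector_derivative (1 + t) powr \<alpha> *\<^sub>R (0 - ((c / (1 + t) powr \<alpha>) *\<^sub>R y t - 0))
        + (\<alpha> * (1 + t) powr (\<alpha> - 1)) *\<^sub>R (y t - (Y t - Y t))) (at t within {0..})"
      unfolding w_def
      by (intro has_vector_derivative_scaleR has_vector_derivative_diff Y has_vector_derivative_const)
        (use t0 in \<open>auto intro!: derivative_eq_intros\<close>)
    then have w': "(w has_vector_derivative (- \<mu>) *\<^sub>R y t) (at t within {0..})"
      using t0 by (simp add: \<mu>_def scaleR_left_diff_distrib)
    have "((\<lambda>s. (1 + s) powr \<alpha>) \<longlongrightarrow> (1 + t) powr \<alpha>) (at_right t)"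
      using t0 by (intro tendsto_intros) auto
    moreover have "(1 + t) powr \<alpha> < (1 + e) * (1 + t) powr \<alpha>"
      using e t0 by simp
    ultimately have "\<forall>\<^sub>F s in at_right t. (1 + s) powr \<alpha> < (1 + e) * (1 + t) powr \<alpha>"
      by (rule order_tendstoD)
    moreover have "\<forall>\<^sub>F s in at_right t. t < s \<and> s < t + 1 / c"
      using c_pos by (auto simp: eventually_at_right_field intro!: exI[of _ "t + 1/c"])
    moreover note eventually_at_right_derivative_bound[OF w' t0 e]
      eventually_at_right_derivative_bound[OF I'[OF t0] t0 e]
    ultimately show "\<forall>\<^sub>F s in at_right t. N s + c/2 * I s - D s - (N t + c/2 * I t - D t)
        \<le> e * ((1 + c/2) * s + D s - ((1 + c/2) * t + D t))"
    proof eventually_elim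
      case (elim s)
      then have ts: "t < s" "s - t < 1 / c" by auto
      \<comment> \<open>The restriction \<open>s - t < 1 / c\<close> keeps this product at most 1,
        hence below the weight. The scalar in front of \<open>y t\<close> is then nonnegative and
        leaves the norm without an absolute value.\<close>
      have "(s - t) * \<mu> \<le> (1 / c) * c"
        using ts mu c_pos by (intro mult_mono) auto
      then have sm: "(s - t) * \<mu> \<le> (1 + t) powr \<alpha>"
        using powr_ge_1[OF t0] c_pos by simp
      have "norm (w s) \<le> norm (w t + (s - t) *\<^sub>R (- \<mu>) *\<^sub>R y t) + e * (s - t)"
        using norm_triangle_ineq2[of "w s" "w t + (s - t) *\<^sub>R (- \<mu>) *\<^sub>R y t"] elim
        by (simp add: algebra_simps)
      moreover have "norm (w t + (s - t) *\<^sub>R (- \<mu>) *\<^sub>R y t) = ((1 + t) powr \<alpha> - (s - t) * \<mu>) * norm (y t)"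
        using sm by (simp add: w_def flip: scaleR_left_diff_distrib)
      moreover have "(s - t) * (c / 2) * norm (y t) \<le> (s - t) * \<mu> * norm (y t)"
        using mu ts by (intro mult_right_mono mult_left_mono) auto
      then have "((1 + t) powr \<alpha> - (s - t) * \<mu>) * norm (y t) \<le> N t - (s - t) * (c / 2) * norm (y t)"
        by (simp only: N_def left_diff_distrib[of "(1 + t) powr \<alpha>"] diff_left_mono)
      ultimately have ws: "norm (w s) \<le> N t - (s - t) * (c / 2) * norm (y t) + e * (s - t)" by linarith
      have int: "k integrable_on {t..s}" "W integrable_on {t..s}"
        using integrable_subinterval_real[OF k_int[of s], of t s]
          integrable_subinterval_real[OF W_int[of s], of t s] t0 by (auto simp: W_def[abs_def])
      have k0: "0 \<le> integral {t..s} k"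
        by (rule integral_nonneg[OF int(1)]) (use k_nonneg t0 in auto)
      have Dst: "D s - D t = integral {t..s} W"
        unfolding D_def using integral_diff_eq[of t s W] t0 ts W_int by (simp add: W_def[abs_def])
      \<comment> \<open>The weight is nondecreasing, so its value at the left end may be replaced by
        the weight inside the integral. Passing from the weight at \<open>s\<close> to the one at
        \<open>t\<close> costs the factor \<open>1 + e\<close>.\<close>
      have "(1 + t) powr \<alpha> * integral {t..s} k = integral {t..s} (\<lambda>r. (1 + t) powr \<alpha> * k r)"
        by simp
      also have "\<dots> \<le> integral {t..s} W"
      proof (rule integral_le[OF integrable_on_mult_right[OF int(1)] int(2)])
        fix r assume "r \<in> {t..s}"
        then show "(1 + t) powr \<alpha> * k r \<le> W r"
          unfolding W_def using k_nonneg t0 alpha_nonneg by (intro mult_right_mono powr_mono2) auto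
      qed
      finally have kD: "(1 + t) powr \<alpha> * integral {t..s} k \<le> D s - D t" using Dst by simp
      have "w s + (1 + s) powr \<alpha> *\<^sub>R ((y s + Y s) - (y t + Y t)) = (1 + s) powr \<alpha> *\<^sub>R y s"
        unfolding w_def by (simp flip: scaleR_right_distrib)
      then have "N s = norm (w s + (1 + s) powr \<alpha> *\<^sub>R ((y s + Y s) - (y t + Y t)))"
        by (simp add: N_def)
      also have "\<dots> \<le> norm (w s) + norm ((1 + s) powr \<alpha> *\<^sub>R ((y s + Y s) - (y t + Y t)))"
        by (rule norm_triangle_ineq)
      also have "norm ((1 + s) powr \<alpha> *\<^sub>R ((y s + Y s) - (y t + Y t))) \<le> (1 + s) powr \<alpha> * integral {t..s} k"
        using step[of t s] t0 ts by (simp add: mult_left_mono)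
      also have "\<dots> \<le> ((1 + e) * (1 + t) powr \<alpha>) * integral {t..s} k"
        using elim k0 by (intro mult_right_mono) auto
      also have "\<dots> \<le> (1 + e) * (D s - D t)"
        using kD e by (simp add: mult.assoc)
      finally have Ns: "N s \<le> norm (w s) + (1 + e) * (D s - D t)" by simp
      have "I s - I t \<le> (s - t) * norm (y t) + e * (s - t)"
        using elim by (simp add: abs_le_iff)
      then have "c/2 * (I s - I t) \<le> c/2 * ((s - t) * norm (y t) + e * (s - t))"
        using c_pos by (intro mult_left_mono) auto
      then show ?case using ws Ns by (simp add: field_simps)
    qed
  qed
  moreover have "I b - I a = integral {a..b} (\<lambda>t. norm (y t))"
    unfolding I_def using a
    by (intro integral_diff_eq integrable_continuous_interval continuous_on_subset[OF ycont]) auto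
  then have "c / 2 * I b - c / 2 * I a = c / 2 * integral {a..b} (\<lambda>t. norm (y t))"
    by (simp only: right_diff_distrib[symmetric])
  moreover have "D b - D a = integral {a..b} W"
    unfolding D_def using a W_int by (intro integral_diff_eq) (auto simp: W_def[abs_def])
  ultimately show ?thesis
    unfolding N_def W_def[symmetric] by linarith
qed

text \<open>The integrals over \<open>{0..T}\<close> increase with \<open>T\<close> and are bounded.
  Once they are within \<open>e\<close> of their supremum, at most \<open>e\<close> can still be
  added.\<close>

lemma eventually_small_tail:
  fixes f :: "real \<Rightarrow> real"
  assumes int: "\<And>T. f integrable_on {0..T}" and nonneg: "\<And>t. t \<ge> 0 \<Longrightarrow> 0 \<le> f t"
    and bd: "\<And>T. T \<ge> 0 \<Longrightarrow> integral {0..T} f \<le> M" and "e > 0"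
  obtains a where "a \<ge> 0" "\<And>s t. a \<le> s \<Longrightarrow> s \<le> t \<Longrightarrow> integral {s..t} f \<le> e"
proof -
  define S where "S = (\<lambda>T. integral {0..T} f) ` {0..}"
  have bdd: "bdd_above S" unfolding S_def by (rule bdd_aboveI2[where M = M]) (use bd in auto)
  have "S \<noteq> {}" by (auto simp: S_def)
  then obtain z where "z \<in> S" "Sup S - e < z"
    using less_cSup_iff[OF _ bdd, of "Sup S - e"] \<open>e > 0\<close> by auto
  then obtain a where a: "a \<ge> 0" "Sup S - e < integral {0..a} f" by (auto simp: S_def)
  have "integral {s..t} f \<le> e" if st: "a \<le> s" "s \<le> t" for s t
  proof -
    have "integral {0..t} f \<le> Sup S"
      using st a by (intro cSup_upper[OF _ bdd]) (auto simp: S_def)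
    moreover have "integral {0..a} f \<le> integral {0..s} f"
      using a st int nonneg by (intro integral_subset_le) auto
    ultimately show ?thesis
      using integral_diff_eq[of s t f] int a st by simp
  qed
  with a(1) show thesis by (rule that)
qed

text \<open>Once the weight varies slowly, \<open>weighted_step\<close> bounds the integral of
  \<open>norm (y t)\<close>. For the decay, a weighted norm staying above a positive level would
  force \<open>norm (y t)\<close> above a multiple of \<open>1 / (1 + t)\<close>, because \<alpha> <
  1, contradicting that bound. After the weighted norm has become small once,
  \<open>weighted_step\<close> lets it grow only by a small tail of the forcing.\<close>

lemma weighted_decay:
  fixes y Y :: "real \<Rightarrow> 'b::real_normed_vector" and k :: "real \<Rightarrow> real"
  assumes cont: "continuous_on {0..} y"
    and Y: "\<And>t. t \<ge> 0 \<Longrightarrow> (Y has_vector_derivative (c / (1 + t) powr \<alpha>) *\<^sub>R y t) (at t within {0..})"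
    and k_nonneg: "\<And>t. t \<ge> 0 \<Longrightarrow> 0 \<le> k t"
    and k_int: "\<And>T. k integrable_on {0..T}"
    and W_int: "\<And>T. (\<lambda>t. (1 + t) powr \<alpha> * k t) integrable_on {0..T}"
    and W_bd: "\<And>T. T \<ge> 0 \<Longrightarrow> integral {0..T} (\<lambda>t. (1 + t) powr \<alpha> * k t) \<le> M"
    and step: "\<And>a b. 0 \<le> a \<Longrightarrow> a \<le> b \<Longrightarrow> norm ((y b + Y b) - (y a + Y a)) \<le> integral {a..b} k"
  shows "\<exists>C. \<forall>T\<ge>0. integral {0..T} (\<lambda>t. norm (y t)) \<le> C"
    and "((\<lambda>t. (1 + t) powr \<alpha> * norm (y t)) \<longlongrightarrow> 0) at_top"
proof -
  define W where "W t = (1 + t) powr \<alpha> * k t" for t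
  define N where "N t = (1 + t) powr \<alpha> * norm (y t)" for t
  have N0: "N t \<ge> 0" for t by (simp add: N_def)
  have W0: "W t \<ge> 0" if "t \<ge> 0" for t using k_nonneg[OF that] by (simp add: W_def)
  have Wint: "W integrable_on {0..T}" for T using W_int by (simp add: W_def[abs_def])
  have Wbd: "T \<ge> 0 \<Longrightarrow> integral {0..T} W \<le> M" for T using W_bd by (simp add: W_def[abs_def])
  have yint: "(\<lambda>t. norm (y t)) integrable_on {a..b}" if "0 \<le> a" for a b
    using that by (intro integrable_continuous_interval continuous_intros continuous_on_subset[OF cont]) auto
  obtain T0 where T0: "T0 \<ge> 0" "\<And>t. T0 \<le> t \<Longrightarrow> \<alpha> * (1 + t) powr (\<alpha> - 1) \<le> c / 2"
  proof -
    obtain T where T: "\<And>t. T \<le> t \<Longrightarrow> (1 + t) powr (\<alpha> - 1) \<le> c / 2"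
      using eventually_powr_small[of "c/2"] c_pos by (auto simp: eventually_at_top_linorder)
    show thesis
    proof (rule that[of "max 0 T"])
      fix t assume "max 0 T \<le> t"
      then have "(1 + t) powr (\<alpha> - 1) \<le> c / 2" using T by simp
      moreover have "\<alpha> * (1 + t) powr (\<alpha> - 1) \<le> (1 + t) powr (\<alpha> - 1)"
        using alpha_nonneg alpha_less_1 by (intro mult_left_le_one_le) auto
      ultimately show "\<alpha> * (1 + t) powr (\<alpha> - 1) \<le> c / 2" by linarith
    qed simp
  qed
  have est: "N b + c / 2 * integral {a..b} (\<lambda>t. norm (y t)) \<le> N a + integral {a..b} W"
    if "T0 \<le> a" "a \<le> b" for a b
    unfolding N_def W_def using that T0
    by (intro weighted_step[OF cont Y k_nonneg k_int W_int step]) auto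
  have "\<forall>T\<ge>0. integral {0..T} (\<lambda>t. norm (y t)) \<le> integral {0..T0} (\<lambda>t. norm (y t)) + 2 / c * (N T0 + M)"
  proof (intro allI impI)
    fix T :: real assume "T \<ge> 0"
    define b where "b = max T T0"
    have "c / 2 * integral {T0..b} (\<lambda>t. norm (y t)) \<le> N T0 + integral {T0..b} W"
      using est[of T0 b] N0[of b] by (simp add: b_def)
    also have "integral {T0..b} W \<le> integral {0..b} W"
      using T0 W0 by (intro integral_subset_le integrable_subinterval_real[OF Wint[of b]] Wint) auto
    also have "\<dots> \<le> M" using T0 by (intro Wbd) (simp add: b_def)
    finally have "integral {T0..b} (\<lambda>t. norm (y t)) \<le> 2 / c * (N T0 + M)"
      using c_pos by (simp add: field_simps)
    moreover have "integral {0..T} (\<lambda>t. norm (y t)) \<le> integral {0..b} (\<lambda>t. norm (y t))"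
      by (intro integral_subset_le yint) (auto simp: b_def)
    moreover have "integral {0..b} (\<lambda>t. norm (y t)) - integral {0..T0} (\<lambda>t. norm (y t))
        = integral {T0..b} (\<lambda>t. norm (y t))"
      by (intro integral_diff_eq yint) (auto simp: b_def T0)
    ultimately show "integral {0..T} (\<lambda>t. norm (y t)) \<le> integral {0..T0} (\<lambda>t. norm (y t)) + 2 / c * (N T0 + M)"
      by linarith
  qed
  then show *: "\<exists>C. \<forall>T\<ge>0. integral {0..T} (\<lambda>t. norm (y t)) \<le> C" by blast
  then obtain C where C: "\<And>T. T \<ge> 0 \<Longrightarrow> integral {0..T} (\<lambda>t. norm (y t)) \<le> C" by blast
  have "\<forall>\<^sub>F t in at_top. N t < e" if "e > 0" for e
  proof -
    have "e / 3 > 0" using that by simp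
    from eventually_small_tail[OF Wint W0 Wbd this] obtain a1
      where a1: "a1 \<ge> 0" "\<And>s t. a1 \<le> s \<Longrightarrow> s \<le> t \<Longrightarrow> integral {s..t} W \<le> e / 3" by blast
    define a2 where "a2 = max a1 T0"
    have "\<exists>a\<ge>a2. N a \<le> e / 3"
    proof (rule ccontr)
      assume "\<not> (\<exists>a\<ge>a2. N a \<le> e / 3)"
      then have big: "e / 3 < N a" if "a \<ge> a2" for a using that by force
      have a20: "a2 \<ge> 0" using T0 by (simp add: a2_def)
      have C0: "C \<ge> 0" using C[of 0] by simp
      \<comment> \<open>Chosen so that \<open>e / 3 / (1 + t)\<close> has integral
        \<open>C + 1\<close> over \<open>{a2..b}\<close>, one more than the bound \<open>C\<close>
        permits.\<close>
      define b where "b = (1 + a2) * exp (3 * (C + 1) / e) - 1"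
      have "1 + a2 \<le> (1 + a2) * exp (3 * (C + 1) / e)"
        using a20 C0 that by simp
      then have ab: "a2 \<le> b" by (simp add: b_def)
      have "((\<lambda>t. e / 3 / (1 + t)) has_integral e / 3 * ln (1 + b) - e / 3 * ln (1 + a2)) {a2..b}"
        using ab a20
        by (intro fundamental_theorem_of_calculus)
          (auto intro!: derivative_eq_intros simp: field_simps simp flip: has_real_derivative_iff_has_vector_derivative)
      moreover have "e / 3 * ln (1 + b) - e / 3 * ln (1 + a2) = C + 1"
      proof -
        have "ln (1 + b) = ln (1 + a2) + 3 * (C + 1) / e"
          using a20 by (simp add: b_def ln_mult)
        then show ?thesis using that by (simp add: field_simps)
      qed
      ultimately have hi: "((\<lambda>t. e / 3 / (1 + t)) has_integral C + 1) {a2..b}" by simp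
      have "C + 1 \<le> integral {a2..b} (\<lambda>t. norm (y t))"
      proof (rule has_integral_le[OF hi integrable_integral[OF yint[OF a20]]])
        fix t assume t: "t \<in> {a2..b}"
        have "e / 3 < (1 + t) powr \<alpha> * norm (y t)" using big[of t] t by (simp add: N_def)
        also have "\<dots> \<le> (1 + t) powr 1 * norm (y t)"
          using a20 t alpha_less_1 by (intro mult_right_mono powr_mono) auto
        finally show "e / 3 / (1 + t) \<le> norm (y t)"
          using a20 t by (simp add: field_simps)
      qed
      also have "\<dots> \<le> integral {0..b} (\<lambda>t. norm (y t))"
        using a20 by (intro integral_subset_le yint) auto
      also have "\<dots> \<le> C" using ab a20 by (intro C) simp
      finally show False by simp
    qed
    then obtain a where a: "a \<ge> a2" "N a \<le> e / 3" by blast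
    have "N b < e" if b: "b \<ge> a" for b
    proof -
      have "T0 \<le> a" "a1 \<le> a" using a by (auto simp: a2_def)
      have "0 \<le> integral {a..b} (\<lambda>t. norm (y t))"
        using \<open>T0 \<le> a\<close> T0 by (intro integral_nonneg yint) auto
      then have "0 \<le> c / 2 * integral {a..b} (\<lambda>t. norm (y t))" using c_pos by simp
      then show ?thesis
        using est[OF \<open>T0 \<le> a\<close> b] a1(2)[OF \<open>a1 \<le> a\<close> b] a(2) \<open>e / 3 > 0\<close> by linarith
    qed
    then show ?thesis by (auto simp: eventually_at_top_linorder)
  qed
  then show "((\<lambda>t. (1 + t) powr \<alpha> * norm (y t)) \<longlongrightarrow> 0) at_top"
    using N0 unfolding N_def[symmetric]
    by (intro order_tendstoI) (auto intro!: always_eventually elim: less_le_trans)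
qed

end

section \<open>Gronwall inequality and pointwise Lyapunov bounds\<close>

lemma gronwall_dissipation:
  fixes L dL d \<beta> :: "real \<Rightarrow> real"
  assumes a: "0 \<le> a"
    and L': "\<And>t. a \<le> t \<Longrightarrow> (L has_real_derivative dL t) (at t within {0..})"
    and dL: "\<And>t. a \<le> t \<Longrightarrow> dL t \<le> - d t + \<beta> t * (1 + L t)"
    and L0: "\<And>t. a \<le> t \<Longrightarrow> 0 \<le> L t"
    and d: "continuous_on {0..} d" "\<And>t. 0 \<le> t \<Longrightarrow> 0 \<le> d t"
    and \<beta>: "continuous_on {0..} \<beta>" "\<And>T. 0 \<le> T \<Longrightarrow> integral {0..T} \<beta> \<le> C" "\<And>t. 0 \<le> t \<Longrightarrow> 0 \<le> \<beta> t"
    and T: "a \<le> T"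
  shows "integral {a..T} d \<le> exp C * (1 + L a)"
proof -
  define B where "B t = integral {0..t} \<beta>" for t
  define I where "I t = integral {0..t} d" for t
  have B': "(B has_real_derivative \<beta> t) (at t within {0..})" if "t \<ge> 0" for t
    unfolding has_real_derivative_iff_has_vector_derivative B_def
    using \<beta>(1) that by (rule integral_has_vector_derivative_ray)
  have I': "(I has_real_derivative d t) (at t within {0..})" if "t \<ge> 0" for t
    unfolding has_real_derivative_iff_has_vector_derivative I_def
    using d(1) that by (rule integral_has_vector_derivative_ray)
  \<comment> \<open>The integrating factor \<open>exp (- B t)\<close> cancels the growth term, and
    \<open>B t \<le> C\<close> lets the damped dissipation absorb \<open>exp (- C) * d t\<close>.
    Hence \<open>Z\<close> is nonincreasing.\<close>
  define Z where "Z t = (1 + L t) * exp (- B t) + exp (- C) * I t" for t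
  have Z': "(Z has_real_derivative exp (- B t) * (dL t - \<beta> t * (1 + L t)) + exp (- C) * d t)
    (at t within {0..})" if "a \<le> t" for t
    unfolding Z_def using that a
    by (auto intro!: derivative_eq_intros L' B' I' simp: algebra_simps)
  have "Z T \<le> Z a"
  proof (rule DERIV_nonpos_imp_decreasing_open[OF T])
    fix t assume t: "a < t" "t < T"
    have "at t within {0..} = at t" using t a by (intro at_within_interior) auto
    then have "DERIV Z t :> exp (- B t) * (dL t - \<beta> t * (1 + L t)) + exp (- C) * d t"
      using Z'[of t] t by simp
    moreover have "exp (- B t) * (dL t - \<beta> t * (1 + L t)) \<le> exp (- B t) * (- d t)"
      using dL[of t] t by (intro mult_left_mono) auto
    moreover have "exp (- C) * d t \<le> exp (- B t) * d t"
      using t a \<beta>(2)[of t] d(2)[of t] by (intro mult_right_mono) (auto simp: B_def)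
    ultimately show "\<exists>y. DERIV Z t :> y \<and> y \<le> 0" by (intro exI conjI) (assumption, simp)
  next
    show "continuous_on {a..T} Z"
      by (rule DERIV_continuous_on, rule DERIV_subset[OF Z']) (use a in auto)
  qed
  moreover have "0 \<le> (1 + L T) * exp (- B T)" using L0[OF T] by simp
  moreover have "0 \<le> B a"
    unfolding B_def
  proof (rule integral_nonneg)
    show "\<beta> integrable_on {0..a}"
      by (rule integrable_continuous_interval, rule continuous_on_subset[OF \<beta>(1)]) auto
  qed (use \<beta>(3) in auto)
  then have "exp (- B a) \<le> 1" by simp
  then have "(1 + L a) * exp (- B a) \<le> 1 + L a"
    using L0[of a] mult_left_mono[of "exp (- B a)" 1 "1 + L a"] by simp
  ultimately have "exp (- C) * (I T - I a) \<le> 1 + L a"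
    by (simp add: Z_def right_diff_distrib)
  moreover have "I T - I a = integral {a..T} d"
    unfolding I_def using a T
    by (intro integral_diff_eq integrable_continuous_interval continuous_on_subset[OF d(1)]) auto
  ultimately show ?thesis by (simp add: exp_minus field_simps)
qed

lemma has_real_derivative_inner:
  fixes f g :: "real \<Rightarrow> 'a::real_inner"
  assumes "(f has_vector_derivative f') (at t within S)" "(g has_vector_derivative g') (at t within S)"
  shows "((\<lambda>t. f t \<bullet> g t) has_real_derivative f t \<bullet> g' + f' \<bullet> g t) (at t within S)"
  unfolding has_real_derivative_iff_has_vector_derivative
  by (rule bounded_bilinear.has_vector_derivative[OF bounded_bilinear_inner assms])

lemma young_ineq: "0 < k \<Longrightarrow> a * b \<le> k * a\<^sup>2 + b\<^sup>2 / (4 * k)" for a b k :: real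
  using zero_le_power2[of "2 * k * a - b"] by (simp add: field_simps power2_eq_square)

text \<open>Young's inequality with parameter \<open>2 / c\<close> splits the cross term into
  exactly the two squares on the left. The energy and the distance term supply at least twice these
  squares, so one copy survives.\<close>

lemma lyapunov_lower_bound:
  fixes q z :: "'a::real_inner"
  assumes "c > 0" "0 \<le> A" "0 \<le> \<phi>" "B \<le> c / 2"
  shows "2 / c * (A * norm q)\<^sup>2 + c / 8 * (norm z)\<^sup>2
    \<le> 8 / c * A\<^sup>2 * (q \<bullet> q / 2 + \<phi>) + A * (q \<bullet> z) + (c - B) * (z \<bullet> z / 2)"
proof -
  have "- (A * (q \<bullet> z)) \<le> (A * norm q) * norm z"
    using mult_left_mono[OF Cauchy_Schwarz_ineq2[of q z] \<open>0 \<le> A\<close>]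
      mult_left_mono[OF abs_ge_minus_self[of "q \<bullet> z"] \<open>0 \<le> A\<close>] by (simp add: mult.assoc)
  also have "\<dots> \<le> 2 / c * (A * norm q)\<^sup>2 + c / 8 * (norm z)\<^sup>2"
    using young_ineq[of "2 / c" "A * norm q" "norm z"] \<open>c > 0\<close> by (simp add: field_simps)
  finally have 1: "- (A * (q \<bullet> z)) \<le> 2 / c * (A * norm q)\<^sup>2 + c / 8 * (norm z)\<^sup>2" .
  have "8 / c * A\<^sup>2 * (q \<bullet> q / 2) \<le> 8 / c * A\<^sup>2 * (q \<bullet> q / 2 + \<phi>)"
    using assms by (intro mult_left_mono) auto
  moreover have "8 / c * A\<^sup>2 * (q \<bullet> q / 2) = 2 * (2 / c * (A * norm q)\<^sup>2)"
    by (simp add: power_mult_distrib power2_norm_eq_inner)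
  moreover have "2 * (c / 8 * (norm z)\<^sup>2) \<le> (c - B) * (z \<bullet> z / 2)"
    using mult_right_mono[of "c / 2" "c - B" "z \<bullet> z / 2"] assms
    by (simp add: power2_norm_eq_inner)
  ultimately show ?thesis using 1 by linarith
qed

text \<open>The coefficient \<open>c - \<alpha> * B\<close> of the squared distance is the one for
  which all terms in \<open>q \<bullet> z\<close> cancel. Hypothesis \<open>P\<close> yields
  \<open>- A * \<phi>\<close>, which absorbs the potential energy gained from the growing weight,
  and \<open>- r * (A * norm p)\<close>, half of which pays for the pairing of \<open>p\<close> with
  \<open>R\<close>. Everything left over carries a factor \<open>norm R\<close> or \<open>E\<close>,
  and its cofactor is controlled by \<open>1 + L\<close>.\<close>

lemma lyapunov_derivative_bound:
  fixes q z p R :: "'a::real_inner"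
  assumes c: "c > 0" and \<alpha>: "0 \<le> \<alpha>" "\<alpha> \<le> 1" and A: "0 < A" and B: "0 \<le> B" and E: "0 \<le> E"
    and \<phi>: "0 \<le> \<phi>" and P: "\<phi> + r * norm p \<le> p \<bullet> z"
    and KB: "8 / c * B \<le> 1 / 2" and aB: "\<alpha> * B \<le> c / 2" and KR: "8 / c * (A * norm R) \<le> r / 2"
    and L: "2 / c * (A * norm q)\<^sup>2 + c / 8 * (norm z)\<^sup>2 \<le> L"
  shows "8 / c * (2 * \<alpha> * (A * B) * (q \<bullet> q / 2 + \<phi>) + A\<^sup>2 * (- (c / A) * (q \<bullet> q) + p \<bullet> R))
    + (\<alpha> * B * (q \<bullet> z) + A * (- (c / A) * (q \<bullet> z) - p \<bullet> z + q \<bullet> (q + R)))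
    + ((c - \<alpha> * B) * ((q + R) \<bullet> z) + \<alpha> * (1 - \<alpha>) * E * (z \<bullet> z / 2))
    \<le> - (r / 2 * (A * norm p)) + (5 + c + 4 / c) * (norm R + E) * (1 + L)"
    (is "?lhs \<le> _")
proof -
  have eq: "?lhs = 8 / c * B * \<alpha> * (A * (q \<bullet> q)) + 2 * \<alpha> * (8 / c * B) * (A * \<phi>)
      - 7 * (A * (q \<bullet> q)) + 8 / c * A\<^sup>2 * (p \<bullet> R) - A * (p \<bullet> z) + A * (q \<bullet> R)
      + (c - \<alpha> * B) * (R \<bullet> z) + \<alpha> * (1 - \<alpha>) * (E * (z \<bullet> z / 2))"
  proof -
    \<comment> \<open>The damping rate \<open>g\<close> cancels one weight and
      \<open>k * c = 8\<close>. So \<open>A * (q \<bullet> q)\<close> gets -8 from the energy and +1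
      from the cross term.\<close>
    define k g where "k = 8 / c" and "g = c / A"
    have kg: "A * g = c" "k * c = 8" using A c by (auto simp: k_def g_def)
    have e1: "A\<^sup>2 * (- g * u + w) = - (c * (A * u)) + A\<^sup>2 * w" for u w
      unfolding kg(1)[symmetric] by (simp add: power2_eq_square algebra_simps)
    have e2: "A * (- g * u - w + y) = - (c * u) - A * w + A * y" for u w y
      unfolding kg(1)[symmetric] by (simp add: algebra_simps)
    have e3: "k * (u + (- (c * w) + y)) = k * u - 8 * w + k * y" for u w y
      unfolding kg(2)[symmetric] by (simp add: algebra_simps)
    show ?thesis
      unfolding k_def[symmetric] g_def[symmetric] e1 e2 e3 inner_add_left inner_add_right
      by (simp add: field_simps)
  qed
  have Q: "0 \<le> A * (q \<bullet> q)" using A by simp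
  have t1: "8 / c * B * \<alpha> * (A * (q \<bullet> q)) \<le> A * (q \<bullet> q)"
  proof -
    have "8 / c * B * \<alpha> \<le> 1 * 1" using KB \<alpha> B c by (intro mult_mono) auto
    then have "8 / c * B * \<alpha> * (A * (q \<bullet> q)) \<le> 1 * (A * (q \<bullet> q))"
      using Q by (intro mult_right_mono) auto
    then show ?thesis by simp
  qed
  have t2: "2 * \<alpha> * (8 / c * B) * (A * \<phi>) \<le> A * \<phi>"
  proof -
    have "2 * \<alpha> * (8 / c * B) \<le> 2 * 1 * (1 / 2)" using KB \<alpha> B c by (intro mult_mono) auto
    then have "2 * \<alpha> * (8 / c * B) * (A * \<phi>) \<le> 1 * (A * \<phi>)"
      using A \<phi> by (intro mult_right_mono) auto
    then show ?thesis by simp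
  qed
  have t3: "8 / c * A\<^sup>2 * (p \<bullet> R) \<le> r / 2 * (A * norm p)"
  proof -
    have "8 / c * A\<^sup>2 * (p \<bullet> R) \<le> 8 / c * A\<^sup>2 * (norm p * norm R)"
      using c by (intro mult_left_mono norm_cauchy_schwarz) auto
    also have "\<dots> = (8 / c * (A * norm R)) * (A * norm p)" by (simp add: power2_eq_square)
    also have "\<dots> \<le> r / 2 * (A * norm p)" using KR A by (intro mult_right_mono) auto
    finally show ?thesis .
  qed
  have t4: "A * \<phi> + r * (A * norm p) \<le> A * (p \<bullet> z)"
    using mult_left_mono[OF P, of A] A by (simp add: algebra_simps)
  have t5: "A * (q \<bullet> R) \<le> norm R * (A * norm q)"
    using mult_left_mono[OF norm_cauchy_schwarz[of q R], of A] A by (simp add: mult_ac)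
  have t6: "(c - \<alpha> * B) * (R \<bullet> z) \<le> norm R * (c * norm z)"
  proof -
    have "(c - \<alpha> * B) * (R \<bullet> z) \<le> (c - \<alpha> * B) * (norm R * norm z)"
      using aB c by (intro mult_left_mono norm_cauchy_schwarz) auto
    also have "\<dots> \<le> c * (norm R * norm z)"
      using \<alpha> B by (intro mult_right_mono) auto
    finally show ?thesis by (simp add: mult_ac)
  qed
  have t7: "\<alpha> * (1 - \<alpha>) * (E * (z \<bullet> z / 2)) \<le> E * ((norm z)\<^sup>2 / 2)"
  proof -
    have "\<alpha> * (1 - \<alpha>) \<le> 1 * 1" using \<alpha> by (intro mult_mono) auto
    then have "\<alpha> * (1 - \<alpha>) * (E * (z \<bullet> z / 2)) \<le> 1 * (E * (z \<bullet> z / 2))"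
      using E by (intro mult_right_mono) auto
    then show ?thesis by (simp add: power2_norm_eq_inner)
  qed
  have sq: "0 \<le> 2 / c * (A * norm q)\<^sup>2" "0 \<le> c / 8 * (norm z)\<^sup>2" using c by auto
  have L0: "0 \<le> L" using L sq by linarith
  \<comment> \<open>Naming these products makes the estimates below linear in \<open>L\<close>,
    \<open>m\<close>, \<open>l\<close> and \<open>h\<close>.\<close>
  define m l h where "m = 4 / c" and "l = 4 / c * L" and "h = c * L"
  have qL: "2 * (A * norm q)\<^sup>2 \<le> h"
  proof -
    have "2 / c * (A * norm q)\<^sup>2 \<le> L" using L sq by linarith
    from mult_left_mono[OF this, of c] show ?thesis using c by (simp add: h_def)
  qed
  have zL: "(norm z)\<^sup>2 \<le> 2 * l"
  proof -
    have "c / 8 * (norm z)\<^sup>2 \<le> L" using L sq by linarith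
    from mult_left_mono[OF this, of "8 / c"] show ?thesis using c by (simp add: l_def)
  qed
  have pos: "0 \<le> h" "0 \<le> l" "0 < m" using L0 c by (auto simp: m_def l_def h_def)
  have expand: "(5 + c + m) * (1 + L) = 5 + c + m + 5 * L + h + l"
    by (simp add: m_def l_def h_def algebra_simps add_divide_distrib)
  \<comment> \<open>The error contains first powers of norms whereas \<open>L\<close> controls their
    squares; this bridges the two and accounts for the 1 in \<open>1 + L\<close>.\<close>
  have two_le: "2 * u \<le> 1 + u\<^sup>2" for u :: real
    using zero_le_power2[of "u - 1"] by (simp add: power2_diff)
  have t8: "A * norm q + c * norm z \<le> (5 + c + m) * (1 + L)"
  proof -
    have "2 * (A * norm q) \<le> 1 + h"
      using two_le[of "A * norm q"] qL pos by simp
    moreover have "2 * norm z \<le> 1 + 2 * l"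
      using order_trans[OF two_le[of "norm z"]] zL by simp
    then have "c * (2 * norm z) \<le> c * (1 + 2 * l)"
      using c by (intro mult_left_mono) auto
    then have "2 * (c * norm z) \<le> c + 8 * L" using c by (simp add: l_def algebra_simps)
    ultimately show ?thesis unfolding expand using L0 c pos by linarith
  qed
  have t9: "(norm z)\<^sup>2 / 2 \<le> (5 + c + m) * (1 + L)"
  proof -
    have "(norm z)\<^sup>2 / 2 \<le> l" using zL by simp
    then show ?thesis unfolding expand using L0 c pos by linarith
  qed
  have "norm R * (A * norm q) + norm R * (c * norm z) \<le> norm R * ((5 + c + m) * (1 + L))"
    using mult_left_mono[OF t8, of "norm R"] by (simp add: distrib_left)
  moreover have "E * ((norm z)\<^sup>2 / 2) \<le> E * ((5 + c + m) * (1 + L))"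
    using t9 E by (rule mult_left_mono)
  moreover have "(5 + c + m) * (norm R + E) * (1 + L)
    = norm R * ((5 + c + m) * (1 + L)) + E * ((5 + c + m) * (1 + L))"
    by (simp add: algebra_simps)
  ultimately show ?thesis
    unfolding eq m_def[symmetric] using t1 t2 t3 t4 t5 t6 t7 Q by linarith
qed

section \<open>The Lyapunov function along a trajectory\<close>

context damping begin

lemma powr_derivs:
  assumes "0 \<le> t"
  shows "((\<lambda>t. (1 + t) powr \<alpha>) has_real_derivative \<alpha> * (1 + t) powr (\<alpha> - 1)) (at t within S)"
    and "((\<lambda>t. (1 + t) powr (\<alpha> - 1)) has_real_derivative (\<alpha> - 1) * (1 + t) powr (\<alpha> - 2)) (at t within S)"
  using assms by (auto intro!: derivative_eq_intros)

text \<open>The integrand is a constant multiple of the derivative of a negative power, hence the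
  bound is uniform in \<open>T\<close>. It keeps the second derivative of the weight from making the
  Gronwall exponent infinite.\<close>

lemma integral_powr_le:
  assumes "0 \<le> T"
  shows "integral {0..T} (\<lambda>t. (1 + t) powr (\<alpha> - 2)) \<le> 1 / (1 - \<alpha>)"
proof -
  have "((\<lambda>t. (\<alpha> - 1) * (1 + t) powr (\<alpha> - 2)) has_integral
      (1 + T) powr (\<alpha> - 1) - (1 + 0) powr (\<alpha> - 1)) {0..T}"
    using assms powr_derivs(2)
    by (intro fundamental_theorem_of_calculus)
      (auto simp flip: has_real_derivative_iff_has_vector_derivative)
  from integral_unique[OF this, unfolded integral_mult_right]
  have "(1 - \<alpha>) * integral {0..T} (\<lambda>t. (1 + t) powr (\<alpha> - 2)) = 1 - (1 + T) powr (\<alpha> - 1)"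
    by (simp add: algebra_simps)
  also have "\<dots> \<le> 1" by simp
  finally show ?thesis using alpha_less_1 by (simp add: field_simps)
qed

text \<open>From some time on, \<open>L\<close> dissipates \<open>r / 2\<close> times the integrand
  up to an error \<open>\<beta> * (1 + L)\<close> with integrable \<open>\<beta>\<close>, so the
  Gronwall bound applies; the time before contributes a constant. The velocity enters
  \<open>L\<close> only through its differentiable part \<open>q\<close>, which is the purpose of
  the splitting \<open>q + R\<close>.\<close>

lemma lyapunov_estimate:
  fixes x q R p :: "real \<Rightarrow> 'b::real_inner" and \<phi> :: "real \<Rightarrow> real"
  assumes r: "0 < r"
    and x': "\<And>t. 0 \<le> t \<Longrightarrow> (x has_vector_derivative q t + R t) (at t within {0..})"
    and q': "\<And>t. 0 \<le> t \<Longrightarrow>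
      (q has_vector_derivative - ((c / (1 + t) powr \<alpha>) *\<^sub>R q t) - p t) (at t within {0..})"
    and \<phi>': "\<And>t. 0 \<le> t \<Longrightarrow> (\<phi> has_real_derivative p t \<bullet> (q t + R t)) (at t within {0..})"
    and \<phi>0: "\<And>t. 0 \<le> t \<Longrightarrow> 0 \<le> \<phi> t"
    and P: "\<And>t. 0 \<le> t \<Longrightarrow> \<phi> t + r * norm (p t) \<le> p t \<bullet> (x t - v)"
    and pcont: "continuous_on {0..} p" and Rcont: "continuous_on {0..} R"
    and RC: "\<And>T. 0 \<le> T \<Longrightarrow> integral {0..T} (\<lambda>t. norm (R t)) \<le> C"
    and R0: "((\<lambda>t. (1 + t) powr \<alpha> * norm (R t)) \<longlongrightarrow> 0) at_top"
  shows "\<exists>C. \<forall>T\<ge>0. integral {0..T} (\<lambda>t. (1 + t) powr \<alpha> * norm (p t)) \<le> C"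
proof -
  define A B E where "A t = (1 + t) powr \<alpha>" and "B t = (1 + t) powr (\<alpha> - 1)"
    and "E t = (1 + t) powr (\<alpha> - 2)" for t
  define z where "z t = x t - v" for t
  define Q S Z where "Q t = q t \<bullet> q t" and "S t = q t \<bullet> z t" and "Z t = z t \<bullet> z t" for t
  have dA: "(A has_real_derivative \<alpha> * B t) (at t within {0..})"
    and dB: "(B has_real_derivative (\<alpha> - 1) * E t) (at t within {0..})" if "0 \<le> t" for t
    using powr_derivs[OF that] by (simp_all add: A_def[abs_def] B_def[abs_def] E_def)
  have dz: "(z has_vector_derivative q t + R t) (at t within {0..})" if "0 \<le> t" for t
    unfolding z_def using has_vector_derivative_diff[OF x'[OF that] has_vector_derivative_const] by simp
  have dQ: "(Q has_real_derivative 2 * (- (c / A t) * Q t - p t \<bullet> q t)) (at t within {0..})" if "0 \<le> t" for t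
    unfolding Q_def
    by (rule DERIV_cong[OF has_real_derivative_inner[OF q'[OF that] q'[OF that]]])
      (simp add: A_def inner_diff_left inner_diff_right inner_commute)
  have dS: "(S has_real_derivative - (c / A t) * S t - p t \<bullet> z t + q t \<bullet> (q t + R t)) (at t within {0..})"
    if "0 \<le> t" for t
    unfolding S_def
    by (rule DERIV_cong[OF has_real_derivative_inner[OF q'[OF that] dz[OF that]]])
      (simp add: A_def inner_diff_left)
  have dZ: "(Z has_real_derivative 2 * ((q t + R t) \<bullet> z t)) (at t within {0..})" if "0 \<le> t" for t
    unfolding Z_def
    by (rule DERIV_cong[OF has_real_derivative_inner[OF dz[OF that] dz[OF that]]])
      (simp add: inner_commute)
  define L where "L t = 8 / c * (A t)\<^sup>2 * (Q t / 2 + \<phi> t) + A t * S t + (c - \<alpha> * B t) * (Z t / 2)" for t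
  define dL where "dL t = 8 / c * (2 * \<alpha> * (A t * B t) * (Q t / 2 + \<phi> t)
      + (A t)\<^sup>2 * (- (c / A t) * Q t + p t \<bullet> R t))
    + (\<alpha> * B t * S t + A t * (- (c / A t) * S t - p t \<bullet> z t + q t \<bullet> (q t + R t)))
    + ((c - \<alpha> * B t) * ((q t + R t) \<bullet> z t) + \<alpha> * (1 - \<alpha>) * E t * (Z t / 2))" for t
  have L': "(L has_real_derivative dL t) (at t within {0..})" if t: "0 \<le> t" for t
  proof -
    have 1: "((\<lambda>t. 8 / c * (A t)\<^sup>2) has_real_derivative 8 / c * (2 * A t * (\<alpha> * B t))) (at t within {0..})"
      by (rule DERIV_cong[OF DERIV_cmult[OF DERIV_power[OF dA[OF t]]]]) simp
    have 2: "((\<lambda>t. Q t / 2 + \<phi> t) has_real_derivative - (c / A t) * Q t + p t \<bullet> R t) (at t within {0..})"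
      by (rule DERIV_cong[OF DERIV_add[OF DERIV_cdivide[OF dQ[OF t]] \<phi>'[OF t]]])
        (simp add: inner_add_right diff_divide_distrib)
    have 3: "((\<lambda>t. c - \<alpha> * B t) has_real_derivative - (\<alpha> * ((\<alpha> - 1) * E t))) (at t within {0..})"
      by (rule DERIV_cong[OF DERIV_diff[OF DERIV_const DERIV_cmult[OF dB[OF t]]]]) simp
    have 4: "((\<lambda>t. Z t / 2) has_real_derivative (q t + R t) \<bullet> z t) (at t within {0..})"
      by (rule DERIV_cong[OF DERIV_cdivide[OF dZ[OF t]]]) simp
    have ring: "k * (2 * A t * (\<alpha> * B t)) * u + y * (k * (A t)\<^sup>2)
        + (\<alpha> * B t * S t + s * A t) + (- (\<alpha> * ((\<alpha> - 1) * E t)) * w + o' * (c - \<alpha> * B t))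
      = k * (2 * \<alpha> * (A t * B t) * u + (A t)\<^sup>2 * y) + (\<alpha> * B t * S t + A t * s)
        + ((c - \<alpha> * B t) * o' + \<alpha> * (1 - \<alpha>) * E t * w)" for k u y s w o' :: real
      by (simp add: algebra_simps)
    show ?thesis
      unfolding L_def dL_def
      by (rule DERIV_cong[OF DERIV_add[OF DERIV_add[OF DERIV_mult[OF 1 2]
        DERIV_mult[OF dA[OF t] dS[OF t]]] DERIV_mult[OF 3 4]] ring])
  qed
  \<comment> \<open>The thresholds are dictated by \<open>lyapunov_derivative_bound\<close>: they
    give \<open>8 / c * B t \<le> 1 / 2\<close> and
    \<open>8 / c * (A t * norm (R t)) \<le> r / 2\<close>.\<close>
  have "\<forall>\<^sub>F t in at_top. B t \<le> c / 16"
    unfolding B_def using c_pos by (intro eventually_powr_small) auto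
  moreover have "\<forall>\<^sub>F t in at_top. A t * norm (R t) < c * r / 16"
    unfolding A_def using c_pos r by (intro order_tendstoD(2)[OF R0]) auto
  ultimately have "\<forall>\<^sub>F t in at_top. B t \<le> c / 16 \<and> A t * norm (R t) < c * r / 16"
    by (rule eventually_conj)
  then obtain T1 where T1: "\<And>t. T1 \<le> t \<Longrightarrow> B t \<le> c / 16 \<and> A t * norm (R t) < c * r / 16"
    by (auto simp: eventually_at_top_linorder)
  define a where "a = max 0 T1"
  have a0: "0 \<le> a" and a: "\<And>t. a \<le> t \<Longrightarrow> B t \<le> c / 16 \<and> A t * norm (R t) < c * r / 16"
    using T1 by (auto simp: a_def)
  have aB: "\<alpha> * B t \<le> c / 2" if "a \<le> t" for t
  proof -
    have "\<alpha> * B t \<le> B t"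
      using alpha_nonneg alpha_less_1 by (intro mult_left_le_one_le) (auto simp: B_def)
    then show ?thesis using a[OF that] c_pos by linarith
  qed
  have lower: "2 / c * (A t * norm (q t))\<^sup>2 + c / 8 * (norm (z t))\<^sup>2 \<le> L t" if t: "a \<le> t" for t
    unfolding L_def Q_def S_def Z_def
    using t a0 by (intro lyapunov_lower_bound c_pos aB \<phi>0) (auto simp: A_def)
  define M where "M = 5 + c + 4 / c"
  have M: "0 \<le> M" using c_pos by (simp add: M_def add_nonneg_nonneg)
  define \<beta> where "\<beta> t = M * (norm (R t) + E t)" for t
  define d where "d t = r / 2 * (A t * norm (p t))" for t
  have Acont: "continuous_on {0..} A" unfolding A_def by (intro continuous_intros) auto
  have Econt: "continuous_on {0..} E" unfolding E_def by (intro continuous_intros) auto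
  \<comment> \<open>The exponent bounds the integral of \<open>\<beta>\<close>: \<open>C\<close>
    comes from \<open>R\<close>, and \<open>1 / (1 - \<alpha>)\<close> from
    \<open>E\<close>.\<close>
  have bound: "integral {a..T} d \<le> exp (M * (C + 1 / (1 - \<alpha>))) * (1 + L a)" if T: "a \<le> T" for T
  proof (rule gronwall_dissipation[OF a0 L' _ _ _ _ _ _ _ T])
    fix t assume t: "a \<le> t"
    then have t0: "0 \<le> t" using a0 by simp
    show "0 \<le> t" by (fact t0)
    have At: "0 < A t" using t0 by (simp add: A_def)
    show "dL t \<le> - d t + \<beta> t * (1 + L t)"
      unfolding dL_def d_def \<beta>_def M_def Q_def S_def Z_def
    proof (rule lyapunov_derivative_bound[OF c_pos])
      show "\<phi> t + r * norm (p t) \<le> p t \<bullet> z t" using P[OF t0] by (simp add: z_def)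
      show "8 / c * B t \<le> 1 / 2" using a[OF t] c_pos by (simp add: field_simps)
      show "8 / c * (A t * norm (R t)) \<le> r / 2" using a[OF t] c_pos by (simp add: field_simps)
    qed (use alpha_nonneg alpha_less_1 At \<phi>0[OF t0] aB[OF t] lower[OF t] in \<open>auto simp: B_def E_def\<close>)
    show "0 \<le> L t"
      by (rule order_trans[OF _ lower[OF t]]) (use c_pos in auto)
  next
    show "continuous_on {0..} d" unfolding d_def by (intro continuous_intros Acont pcont)
    show "continuous_on {0..} \<beta>" unfolding \<beta>_def by (intro continuous_intros Econt Rcont)
    show "0 \<le> d t" for t using r by (simp add: d_def A_def)
    show "0 \<le> \<beta> t" for t using M by (simp add: \<beta>_def E_def)
    show "integral {0..T} \<beta> \<le> M * (C + 1 / (1 - \<alpha>))" if "0 \<le> T" for T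
    proof -
      have "integral {0..T} (\<lambda>t. norm (R t) + E t) = integral {0..T} (\<lambda>t. norm (R t)) + integral {0..T} E"
        by (intro Henstock_Kurzweil_Integration.integral_add integrable_continuous_interval
            continuous_intros continuous_on_subset[OF Rcont] continuous_on_subset[OF Econt]) auto
      also have "\<dots> \<le> C + 1 / (1 - \<alpha>)"
        using RC[OF that] integral_powr_le[OF that] by (simp add: E_def[abs_def])
      finally show ?thesis unfolding \<beta>_def using M by (simp add: mult_left_mono)
    qed
  qed
  define w where "w t = A t * norm (p t)" for t
  have wcont: "continuous_on {0..} w" unfolding w_def by (intro continuous_intros Acont pcont)
  have wint: "w integrable_on {s..t}" if "0 \<le> s" for s t
    by (intro integrable_continuous_interval continuous_on_subset[OF wcont]) (use that in auto)
  define D where "D = 2 / r * (exp (M * (C + 1 / (1 - \<alpha>))) * (1 + L a))"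
  have "integral {0..T} w \<le> integral {0..a} w + D" if "0 \<le> T" for T
  proof -
    define b where "b = max a T"
    have "integral {0..T} w \<le> integral {0..b} w"
      by (intro integral_subset_le wint) (auto simp: b_def w_def A_def)
    moreover have "integral {0..b} w - integral {0..a} w = integral {a..b} w"
      using a0 by (intro integral_diff_eq wint) (auto simp: b_def)
    moreover have "integral {a..b} d = r / 2 * integral {a..b} w"
      by (simp add: d_def[abs_def] w_def[abs_def])
    then have "integral {a..b} w \<le> D"
      using bound[of b] r by (simp add: b_def D_def field_simps)
    ultimately show ?thesis by linarith
  qed
  then show ?thesis unfolding w_def A_def by blast
qed

end

section \<open>Convexity inequalities and limits at infinity\<close>

lemma convex_gradient_inequality:
  fixes \<Phi> :: "'a::real_inner \<Rightarrow> real"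
  assumes "convex_on UNIV \<Phi>" and grad: "(\<Phi> has_derivative (\<lambda>h. G \<bullet> h)) (at x)"
  shows "\<Phi> x + G \<bullet> (y - x) \<le> \<Phi> y"
proof -
  have "((\<lambda>s. \<Phi> (x + s *\<^sub>R (y - x))) has_derivative (\<lambda>h. G \<bullet> (h *\<^sub>R (y - x)))) (at_right 0)"
    by (rule has_derivative_at_withinI, rule has_derivative_compose[where g = \<Phi>])
      (use grad in \<open>auto intro!: derivative_eq_intros\<close>)
  then have "((\<lambda>s. \<Phi> (x + s *\<^sub>R (y - x))) has_real_derivative G \<bullet> (y - x)) (at_right 0)"
    by (rule has_derivative_imp_has_field_derivative) simp
  then have "((\<lambda>s. (\<Phi> (x + s *\<^sub>R (y - x)) - \<Phi> x) / s) \<longlongrightarrow> G \<bullet> (y - x)) (at_right 0)"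
    by (simp add: has_field_derivative_iff)
  moreover have "\<forall>\<^sub>F s::real in at_right 0. 0 < s \<and> s < 1"
    by (auto simp: eventually_at_right_field intro!: exI[of _ 1])
  \<comment> \<open>Convexity along the segment bounds each difference quotient by the full
    increment; letting \<open>s\<close> tend to 0 gives the claim.\<close>
  then have "\<forall>\<^sub>F s in at_right 0. (\<Phi> (x + s *\<^sub>R (y - x)) - \<Phi> x) / s \<le> \<Phi> y - \<Phi> x"
  proof eventually_elim
    case (elim s)
    have "x + s *\<^sub>R (y - x) = (1 - s) *\<^sub>R x + s *\<^sub>R y" by (simp add: algebra_simps)
    then have "\<Phi> (x + s *\<^sub>R (y - x)) \<le> (1 - s) * \<Phi> x + s * \<Phi> y"
      using convex_onD[OF assms(1), of s x y] elim by simp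
    then show ?case using elim by (simp add: field_simps)
  qed
  ultimately have "G \<bullet> (y - x) \<le> \<Phi> y - \<Phi> x"
    by (intro tendsto_upperbound) auto
  then show ?thesis by simp
qed

text \<open>The gradient inequality is applied at the point of the ball lying farthest in the
  direction of \<open>G x\<close>. That point is again a minimizer, and the displacement from
  \<open>v\<close> produces the term \<open>r * norm (G x)\<close>.\<close>

lemma interior_argmin_gradient_bound:
  fixes \<Phi> :: "'a::real_inner \<Rightarrow> real"
  assumes "convex_on UNIV \<Phi>" and "\<And>y. (\<Phi> has_derivative (\<lambda>h. G y \<bullet> h)) (at y)"
    and ball: "cball v r \<subseteq> argmin_set \<Phi>" and r: "0 \<le> r"
  shows "\<Phi> x - \<Phi> v + r * norm (G x) \<le> G x \<bullet> (x - v)"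
proof -
  define u where "u = v + r *\<^sub>R sgn (G x)"
  have "u \<in> cball v r" using r by (auto simp: u_def dist_norm norm_sgn)
  then have "\<Phi> u \<le> \<Phi> v" using ball by (auto simp: argmin_set_def)
  moreover have "\<Phi> x + G x \<bullet> (u - x) \<le> \<Phi> u"
    by (rule convex_gradient_inequality) (fact assms)+
  moreover have "G x \<bullet> sgn (G x) = norm (G x)"
    by (cases "G x = 0")
      (simp_all add: sgn_div_norm power2_norm_eq_inner[symmetric] power2_eq_square)
  then have "G x \<bullet> (u - x) = r * norm (G x) - G x \<bullet> (x - v)"
    by (simp add: u_def inner_simps)
  ultimately show ?thesis by linarith
qed

text \<open>The indefinite integral of \<open>k\<close> is continuous, and its increments dominate
  those of \<open>f\<close>.\<close>

lemma continuous_on_dominated_increments: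
  fixes f :: "real \<Rightarrow> 'a::real_normed_vector" and k :: "real \<Rightarrow> real"
  assumes k: "\<And>T. k integrable_on {0..T}"
    and f: "\<And>a b. 0 \<le> a \<Longrightarrow> a \<le> b \<Longrightarrow> norm (f b - f a) \<le> integral {a..b} k"
  shows "continuous_on {0..} f"
proof -
  define K where "K t = integral {0..t} k" for t
  have dist: "dist (f s) (f t) \<le> dist (K s) (K t)" if "0 \<le> s" "0 \<le> t" for s t
  proof -
    have "dist (f s) (f t) \<le> dist (K s) (K t)" if "0 \<le> s" "s \<le> t" for s t
      using f[OF that] integral_diff_eq[OF that k]
      by (simp add: K_def dist_norm norm_minus_commute[of "f s"] abs_minus_commute)
    from this[of s t] this[of t s] that show ?thesis
      by (cases "s \<le> t") (auto simp: dist_commute)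
  qed
  have "continuous (at t within {0..}) f" if t: "0 \<le> t" for t
  proof -
    have "continuous_on {0..t+1} K"
      unfolding K_def by (rule indefinite_integral_continuous_1[OF k])
    then have "continuous_on {0..t+1} f"
      unfolding continuous_on_iff using dist by (meson atLeastAtMost_iff order_le_less_trans)
    then have "continuous (at t within {0..t+1}) f"
      using t by (simp add: continuous_on_eq_continuous_within)
    moreover have "at t within {0..t+1} = at t within {0..}"
      by (rule at_within_nhd[of t "{..<t+1}"]) auto
    ultimately show ?thesis by simp
  qed
  then show ?thesis by (simp add: continuous_on_eq_continuous_within)
qed

text \<open>The values at the integers form a Cauchy sequence, and the tail estimate carries their
  limit over to real times.\<close>

lemma convergent_at_top_if_increments:
  fixes x :: "real \<Rightarrow> 'a::{real_normed_vector,complete_space}"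
  assumes "\<And>e. e > 0 \<Longrightarrow> \<exists>a. \<forall>s\<ge>a. \<forall>t\<ge>s. norm (x t - x s) \<le> e"
  obtains l where "(x \<longlongrightarrow> l) at_top"
proof -
  have tail: "\<exists>a. \<forall>s\<ge>a. \<forall>t\<ge>a. dist (x t) (x s) < e" if "e > 0" for e
  proof -
    obtain a where a: "\<And>s t. a \<le> s \<Longrightarrow> s \<le> t \<Longrightarrow> norm (x t - x s) \<le> e / 2"
      using assms[of "e / 2"] \<open>e > 0\<close> by (meson half_gt_zero)
    have "dist (x t) (x s) < e" if "a \<le> s" "a \<le> t" for s t
      using a[of s t] a[of t s] that \<open>e > 0\<close>
      by (cases "s \<le> t") (auto simp: dist_norm norm_minus_commute)
    then show ?thesis by blast
  qed
  have "Cauchy (\<lambda>n. x (real n))"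
  proof (rule metric_CauchyI)
    fix e :: real assume "e > 0"
    then obtain a where a: "\<And>s t. a \<le> s \<Longrightarrow> a \<le> t \<Longrightarrow> dist (x t) (x s) < e" using tail by meson
    obtain N :: nat where "a \<le> real N" using real_arch_simple by blast
    then show "\<exists>N. \<forall>m\<ge>N. \<forall>n\<ge>N. dist (x (real m)) (x (real n)) < e"
      by (intro exI[of _ N] allI impI a) auto
  qed
  then obtain l where l: "(\<lambda>n. x (real n)) \<longlonglongrightarrow> l"
    using Cauchy_convergent convergent_def by blast
  have "(x \<longlongrightarrow> l) at_top"
  proof (rule tendstoI)
    fix e :: real assume "e > 0"
    then obtain a where a: "\<And>s t. a \<le> s \<Longrightarrow> a \<le> t \<Longrightarrow> dist (x t) (x s) < e / 2"
      using tail[of "e / 2"] by auto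
    have "\<forall>\<^sub>F n in sequentially. dist (x (real n)) l < e / 2"
      using l \<open>e > 0\<close> by (intro tendstoD) auto
    moreover have "\<forall>\<^sub>F n in sequentially. a \<le> real n"
      using filterlim_real_sequentially by (auto simp: filterlim_at_top)
    ultimately have "\<forall>\<^sub>F n in sequentially. dist (x (real n)) l < e / 2 \<and> a \<le> real n"
      by (rule eventually_conj)
    then obtain n where n: "dist (x (real n)) l < e / 2" "a \<le> real n"
      using eventually_happens'[OF sequentially_bot] by blast
    have "dist (x t) l < e" if "a \<le> t" for t
      using dist_triangle[of "x t" l "x (real n)"] a[OF n(2) that] n(1) by linarith
    then show "\<forall>\<^sub>F t in at_top. dist (x t) l < e"
      by (auto simp: eventually_at_top_linorder)
  qed
  then show thesis by (rule that)
qed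

text \<open>A nonzero limit would keep \<open>k\<close> above a positive constant from some time on,
  and its integral would grow linearly.\<close>

lemma limit_zero_if_integral_bounded:
  fixes p :: "real \<Rightarrow> 'a::real_normed_vector" and k :: "real \<Rightarrow> real"
  assumes lim: "(p \<longlongrightarrow> l) at_top" and k: "continuous_on {0..} k"
    and pk: "\<And>t. 0 \<le> t \<Longrightarrow> norm (p t) \<le> k t"
    and C: "\<And>T. 0 \<le> T \<Longrightarrow> integral {0..T} k \<le> C"
  shows "l = 0"
proof (rule ccontr)
  assume "l \<noteq> 0"
  define e where "e = norm l / 2"
  have e: "e > 0" using \<open>l \<noteq> 0\<close> by (simp add: e_def)
  have "\<forall>\<^sub>F t in at_top. e < norm (p t)"
    using \<open>l \<noteq> 0\<close> by (intro order_tendstoD(1)[OF tendsto_norm[OF lim]]) (simp add: e_def)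
  then obtain T1 where T1: "\<And>t. T1 \<le> t \<Longrightarrow> e < norm (p t)" by (auto simp: eventually_at_top_linorder)
  define a b where "a = max 0 T1" and "b = a + (C + 1) / e"
  have C0: "0 \<le> C" using C[of 0] by simp
  have a0: "0 \<le> a" by (simp add: a_def)
  have ab: "a \<le> b" using C0 e by (simp add: b_def)
  have kint: "k integrable_on {s..t}" if "0 \<le> s" for s t
    by (intro integrable_continuous_interval continuous_on_subset[OF k]) (use that in auto)
  have "C + 1 = integral {a..b} (\<lambda>_. e)" using ab e by (simp add: b_def)
  also have "\<dots> \<le> integral {a..b} k"
  proof (rule integral_le[OF integrable_const_ivl kint[OF a0]])
    show "e \<le> k t" if "t \<in> {a..b}" for t
      using T1[of t] pk[of t] that a0 by (simp add: a_def)
  qed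
  also have "\<dots> \<le> integral {0..b} k"
    using a0 order_trans[OF norm_ge_zero pk] by (intro integral_subset_le kint) auto
  also have "\<dots> \<le> C" using ab a0 by (intro C) simp
  finally show False by simp
qed

section \<open>Convergence of the trajectory to a minimizer\<close>

theorem theorem3:
  fixes \<Phi> :: "'a::{real_inner, complete_space} \<Rightarrow> real"
    and grad\<Phi> :: "'a \<Rightarrow> 'a"
    and x x' x'' g :: "real \<Rightarrow> 'a"
    and c \<alpha> :: real
  assumes convex: "convex_on UNIV \<Phi>"
    and grad: "\<And>y. (\<Phi> has_derivative (\<lambda>h. grad\<Phi> y \<bullet> h)) (at y)"
    and grad_cont: "continuous_on UNIV grad\<Phi>"
    and argmin_ne: "argmin_set \<Phi> \<noteq> {}"
    and c_pos: "c > 0"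
    and alpha: "0 \<le> \<alpha>" "\<alpha> < 1"
    and g_L1: "g integrable_on {0..}" "(\<lambda>t. norm (g t)) integrable_on {0..}"
    and x_deriv: "\<And>t. t \<ge> 0 \<Longrightarrow> (x has_vector_derivative x' t) (at t within {0..})"
    and x''_loc: "\<And>T. T \<ge> 0 \<Longrightarrow> (\<lambda>t. norm (x'' t)) integrable_on {0..T}"
    and x'_abs: "\<And>T. T \<ge> 0 \<Longrightarrow> (x'' has_integral (x' T - x' 0)) {0..T}"
    and ode: "AE t in lebesgue. t \<ge> 0 \<longrightarrow>
               x'' t + (c / (1 + t) powr \<alpha>) *\<^sub>R x' t + grad\<Phi> (x t) = g t"
    and g_weight: "(\<lambda>t. (1 + t) powr \<alpha> * norm (g t)) integrable_on {0..}"
    and int_ne: "interior (argmin_set \<Phi>) \<noteq> {}"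
  shows "\<exists>xs \<in> argmin_set \<Phi>. (x \<longlongrightarrow> xs) at_top"
proof -
  interpret damping c \<alpha> using c_pos alpha by unfold_locales
  obtain v r where r: "r > 0" and ball: "cball v r \<subseteq> argmin_set \<Phi>"
    using int_ne mem_interior_cball by (metis ex_in_conv)
  have v: "\<Phi> v \<le> \<Phi> y" for y
    using ball r by (force simp: argmin_set_def)
  define \<gamma> where "\<gamma> t = c / (1 + t) powr \<alpha>" for t
  define p where "p t = grad\<Phi> (x t)" for t
  have xcont: "continuous_on {0..} x"
    by (rule continuous_on_vector_derivative[OF x_deriv]) simp
  have pcont: "continuous_on {0..} p"
    unfolding p_def by (rule continuous_on_compose2[OF grad_cont xcont]) simp
  have x''_inner: "((\<lambda>t. x'' t \<bullet> w) has_integral (x' b - x' a) \<bullet> w) {a..b}" if "0 \<le> a" "a \<le> b" for a b w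
  proof -
    have *: "((\<lambda>t. x'' t \<bullet> w) has_integral (x' T - x' 0) \<bullet> w) {0..T}" if "0 \<le> T" for T
      using has_integral_linear[OF x'_abs[OF that] bounded_linear_inner_left[of w]] by (simp add: o_def)
    have int: "(\<lambda>t. x'' t \<bullet> w) integrable_on {0..b}" using *[of b] that by auto
    then have "(\<lambda>t. x'' t \<bullet> w) integrable_on {a..b}"
      using that by (intro integrable_subinterval_real[OF int]) auto
    moreover have "integral {a..b} (\<lambda>t. x'' t \<bullet> w) = (x' b - x' a) \<bullet> w"
      using integral_diff_eq[OF that int] integral_unique[OF *[of a]] integral_unique[OF *[of b]] that
      by (simp add: inner_diff_left)
    ultimately show ?thesis by (metis integrable_integral)
  qed
  have x''_int: "(\<lambda>t. norm (x'' t)) integrable_on {0..T}" for T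
    using x''_loc[of T] by (cases "0 \<le> T") (auto simp: integrable_on_empty)
  \<comment> \<open>The second derivative is merely integrable, so continuity of the velocity comes
    from its increments being dominated by integrals of \<open>norm (x'' t)\<close>.\<close>
  have x'cont: "continuous_on {0..} x'"
  proof (rule continuous_on_dominated_increments[OF x''_int])
    fix a b :: real assume ab: "0 \<le> a" "a \<le> b"
    show "norm (x' b - x' a) \<le> integral {a..b} (\<lambda>t. norm (x'' t))"
      by (rule norm_increment_le_integral[OF x''_inner[OF ab] integrable_subinterval_real[OF x''_int[of b]]])
        (use ab in auto)
  qed
  have "continuous_on {0..} (\<lambda>t. \<gamma> t *\<^sub>R x' t)"
    unfolding \<gamma>_def by (intro continuous_intros x'cont) (auto simp: add_nonneg_eq_0_iff)
  then obtain X where X: "\<And>t. t \<ge> 0 \<Longrightarrow> (X has_vector_derivative \<gamma> t *\<^sub>R x' t) (at t within {0..})"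
    using continuous_imp_primitive by blast
  obtain G where G: "\<And>t. t \<ge> 0 \<Longrightarrow> (G has_vector_derivative p t) (at t within {0..})"
    using continuous_imp_primitive[OF pcont] by blast
  have g_int: "(\<lambda>t. norm (g t)) integrable_on {a..b}" if "0 \<le> a" for a b
    using that by (intro integrable_on_subinterval[OF g_L1(2)]) auto
  have gW_int: "(\<lambda>t. (1 + t) powr \<alpha> * norm (g t)) integrable_on {0..T}" for T
    by (intro integrable_on_subinterval[OF g_weight]) auto
  define M where "M = integral {0..} (\<lambda>t. (1 + t) powr \<alpha> * norm (g t))"
  have gW: "integral {0..T} (\<lambda>t. (1 + t) powr \<alpha> * norm (g t)) \<le> M" for T
    unfolding M_def by (intro integral_subset_le gW_int g_weight) auto
  have primitive_inner: "((\<lambda>t. f t \<bullet> w) has_integral (F b - F a) \<bullet> w) {a..b}"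
    if "\<And>t. t \<ge> 0 \<Longrightarrow> (F has_vector_derivative f t) (at t within {0..})" "0 \<le> a" "a \<le> b"
    for F f :: "real \<Rightarrow> 'a" and a b w
    using that by (intro has_integral_inner_derivative has_vector_derivative_within_subset[OF that(1)]) auto
  \<comment> \<open>This is the equation in integrated form: paired with any \<open>w\<close>, the
    increment of \<open>x' + X + G\<close> is the integral of \<open>g\<close>. The equation holds
    almost everywhere, so a null set is removed.\<close>
  have balance: "norm ((x' b + X b + G b) - (x' a + X a + G a)) \<le> integral {a..b} (\<lambda>t. norm (g t))"
    if ab: "0 \<le> a" "a \<le> b" for a b
  proof (rule norm_increment_le_integral[OF _ g_int[OF ab(1)]])
    fix w
    obtain N where "N \<in> null_sets lebesgue"
      and N: "{t. \<not> (t \<ge> 0 \<longrightarrow> x'' t + \<gamma> t *\<^sub>R x' t + p t = g t)} \<subseteq> N"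
      using ode unfolding \<gamma>_def p_def by (auto simp: eventually_ae_filter)
    then have "negligible N" by (simp add: negligible_iff_null_sets)
    have "((\<lambda>t. x'' t \<bullet> w + (\<gamma> t *\<^sub>R x' t) \<bullet> w + p t \<bullet> w) has_integral
        (x' b - x' a) \<bullet> w + (X b - X a) \<bullet> w + (G b - G a) \<bullet> w) {a..b}"
      by (intro has_integral_add x''_inner primitive_inner X G ab)
    then have "((\<lambda>t. g t \<bullet> w) has_integral
        (x' b - x' a) \<bullet> w + (X b - X a) \<bullet> w + (G b - G a) \<bullet> w) {a..b}"
    proof (rule has_integral_spike[OF \<open>negligible N\<close>, rotated])
      fix t assume "t \<in> {a..b} - N"
      moreover from this have "0 \<le> t" using ab by simp
      ultimately have "g t = x'' t + \<gamma> t *\<^sub>R x' t + p t" using N by auto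
      then show "g t \<bullet> w = x'' t \<bullet> w + (\<gamma> t *\<^sub>R x' t) \<bullet> w + p t \<bullet> w"
        by (simp add: inner_add_left)
    qed
    then show "((\<lambda>t. g t \<bullet> w) has_integral ((x' b + X b + G b) - (x' a + X a + G a)) \<bullet> w) {a..b}"
      by (simp add: inner_simps algebra_simps)
  qed simp
  \<comment> \<open>A primitive of \<open>\<gamma>\<close>, so that \<open>exp (\<Gamma> t)\<close>
    is the integrating factor of the damped equation for \<open>q\<close>.\<close>
  define \<Gamma> where "\<Gamma> t = c / (1 - \<alpha>) * (1 + t) powr (1 - \<alpha>)" for t
  have \<Gamma>: "(\<Gamma> has_real_derivative \<gamma> t) (at t within S)" if "0 \<le> t" for t S
  proof -
    have "(\<Gamma> has_real_derivative c / (1 - \<alpha>) * ((1 - \<alpha>) * (1 + t) powr (- \<alpha>))) (at t within S)"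
      unfolding \<Gamma>_def using that by (auto intro!: derivative_eq_intros)
    moreover have "c / (1 - \<alpha>) * ((1 - \<alpha>) * (1 + t) powr (- \<alpha>)) = \<gamma> t"
      using alpha by (simp add: \<gamma>_def powr_minus divide_inverse[of c "(1 + t) powr \<alpha>"])
    ultimately show ?thesis by simp
  qed
  have "continuous_on {0..} (\<lambda>t. exp (\<Gamma> t) *\<^sub>R p t)"
    unfolding \<Gamma>_def using alpha by (intro continuous_intros pcont) (auto simp: add_nonneg_eq_0_iff)
  then obtain F where F: "\<And>t. t \<ge> 0 \<Longrightarrow> (F has_vector_derivative exp (\<Gamma> t) *\<^sub>R p t) (at t within {0..})"
    using continuous_imp_primitive by blast
  \<comment> \<open>Variation of constants; the additive constant in \<open>F\<close> only
    determines the initial value of \<open>q\<close>.\<close>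
  define q where "q t = - (exp (- \<Gamma> t) *\<^sub>R F t)" for t
  have q': "(q has_vector_derivative - (\<gamma> t *\<^sub>R q t) - p t) (at t within {0..})" if t: "0 \<le> t" for t
  proof -
    have "((\<lambda>t. exp (- \<Gamma> t)) has_real_derivative - \<gamma> t * exp (- \<Gamma> t)) (at t within {0..})"
      by (auto intro!: derivative_eq_intros \<Gamma>[OF t])
    from has_vector_derivative_minus[OF has_vector_derivative_scaleR[OF this F[OF t]]]
    show ?thesis unfolding q_def by (simp add: exp_minus)
  qed
  define R where "R t = x' t - q t" for t
  have qcont: "continuous_on {0..} q" by (rule continuous_on_vector_derivative[OF q']) simp
  have Rcont: "continuous_on {0..} R" unfolding R_def by (intro continuous_intros x'cont qcont)
  \<comment> \<open>The gradient cancels between \<open>q\<close> and \<open>G\<close>, so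
    \<open>R\<close> obeys the damped equation with \<open>g\<close> as its only forcing. Indeed
    \<open>R + (X + q + G)\<close> equals \<open>x' + X + G\<close>.\<close>
  have Y: "((\<lambda>t. X t + q t + G t) has_vector_derivative (c / (1 + t) powr \<alpha>) *\<^sub>R R t) (at t within {0..})"
    if t: "0 \<le> t" for t
    using has_vector_derivative_add[OF has_vector_derivative_add[OF X[OF t] q'[OF t]] G[OF t]]
    by (simp add: R_def \<gamma>_def algebra_simps)
  have Rstep: "norm ((R b + (X b + q b + G b)) - (R a + (X a + q a + G a))) \<le> integral {a..b} (\<lambda>t. norm (g t))"
    if "0 \<le> a" "a \<le> b" for a b
    using balance[OF that] by (simp add: R_def algebra_simps)
  note R_decay = weighted_decay[OF Rcont Y norm_ge_zero g_int[OF order_refl] gW_int gW Rstep]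
  obtain CR where CR: "\<And>T. 0 \<le> T \<Longrightarrow> integral {0..T} (\<lambda>t. norm (R t)) \<le> CR"
    using R_decay(1) by blast
  have "\<exists>C. \<forall>T\<ge>0. integral {0..T} (\<lambda>t. (1 + t) powr \<alpha> * norm (p t)) \<le> C"
  proof (rule lyapunov_estimate[where \<phi> = "\<lambda>t. \<Phi> (x t) - \<Phi> v", OF r _ _ _ _ _ pcont Rcont CR R_decay(2)])
    fix t :: real assume t: "0 \<le> t"
    show "(x has_vector_derivative q t + R t) (at t within {0..})"
      using x_deriv[OF t] by (simp add: R_def)
    show "(q has_vector_derivative - ((c / (1 + t) powr \<alpha>) *\<^sub>R q t) - p t) (at t within {0..})"
      using q'[OF t] by (simp add: \<gamma>_def)
    have "((\<Phi> \<circ> x) has_vector_derivative p t \<bullet> x' t) (at t within {0..})"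
      unfolding p_def by (rule vector_derivative_diff_chain_within[OF x_deriv[OF t] has_derivative_at_withinI[OF grad]])
    then have "(\<Phi> \<circ> x has_real_derivative p t \<bullet> x' t) (at t within {0..})"
      by (simp add: has_real_derivative_iff_has_vector_derivative)
    from DERIV_diff[OF this DERIV_const[of "\<Phi> v"]]
    show "((\<lambda>t. \<Phi> (x t) - \<Phi> v) has_real_derivative p t \<bullet> (q t + R t)) (at t within {0..})"
      by (simp add: R_def o_def)
    show "0 \<le> \<Phi> (x t) - \<Phi> v" using v by simp
    show "\<Phi> (x t) - \<Phi> v + r * norm (p t) \<le> p t \<bullet> (x t - v)"
      unfolding p_def using r by (intro interior_argmin_gradient_bound convex grad ball) auto
  qed
  then obtain Cp where Cp: "\<And>T. 0 \<le> T \<Longrightarrow> integral {0..T} (\<lambda>t. (1 + t) powr \<alpha> * norm (p t)) \<le> Cp"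
    by blast
  have pWcont: "continuous_on {0..} (\<lambda>t. (1 + t) powr \<alpha> * norm (p t))"
    by (intro continuous_intros pcont) (auto simp: add_nonneg_eq_0_iff)
  have p_int: "(\<lambda>t. norm (p t)) integrable_on {a..b}" if "0 \<le> a" for a b
    using that by (intro integrable_continuous_interval continuous_intros continuous_on_subset[OF pcont]) auto
  have pW_int: "(\<lambda>t. (1 + t) powr \<alpha> * norm (p t)) integrable_on {0..T}" for T
    by (intro integrable_continuous_interval continuous_on_subset[OF pWcont]) auto
  \<comment> \<open>With the weighted integral of the gradient now bounded, \<open>G\<close> moves
    to the forcing side and the decay estimate applies to the whole velocity with \<open>k\<close>
    equal to \<open>norm (g t) + norm (p t)\<close>.\<close>
  have "\<exists>C. \<forall>T\<ge>0. integral {0..T} (\<lambda>t. norm (x' t)) \<le> C"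
  proof (rule weighted_decay(1)[OF x'cont])
    show "(X has_vector_derivative (c / (1 + t) powr \<alpha>) *\<^sub>R x' t) (at t within {0..})" if "0 \<le> t" for t
      using X[OF that] by (simp add: \<gamma>_def)
    show "0 \<le> norm (g t) + norm (p t)" for t by simp
    show "(\<lambda>t. norm (g t) + norm (p t)) integrable_on {0..T}" for T
      by (intro integrable_add g_int p_int) auto
    show "(\<lambda>t. (1 + t) powr \<alpha> * (norm (g t) + norm (p t))) integrable_on {0..T}" for T
      unfolding distrib_left by (intro integrable_add gW_int pW_int)
    show "integral {0..T} (\<lambda>t. (1 + t) powr \<alpha> * (norm (g t) + norm (p t))) \<le> M + Cp" if "0 \<le> T" for T
      unfolding distrib_left Henstock_Kurzweil_Integration.integral_add[OF gW_int pW_int]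
      by (intro add_mono gW Cp that)
    fix a b :: real assume ab: "0 \<le> a" "a \<le> b"
    have "norm (G b - G a) \<le> integral {a..b} (\<lambda>t. norm (p t))"
      by (rule norm_increment_le_integral[OF primitive_inner[OF G ab] p_int[OF ab(1)]]) auto
    then show "norm ((x' b + X b) - (x' a + X a)) \<le> integral {a..b} (\<lambda>t. norm (g t) + norm (p t))"
      using balance[OF ab] norm_triangle_ineq4[of "(x' b + X b + G b) - (x' a + X a + G a)" "G b - G a"]
      by (simp add: Henstock_Kurzweil_Integration.integral_add[OF g_int p_int] ab algebra_simps)
  qed
  then obtain Cx where Cx: "\<And>T. 0 \<le> T \<Longrightarrow> integral {0..T} (\<lambda>t. norm (x' t)) \<le> Cx" by blast
  have x'_int: "(\<lambda>t. norm (x' t)) integrable_on {a..b}" if "0 \<le> a" for a b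
    using that by (intro integrable_continuous_interval continuous_intros continuous_on_subset[OF x'cont]) auto
  \<comment> \<open>Finite length: increments of \<open>x\<close> are bounded by tails of the
    integral of \<open>norm (x' t)\<close>.\<close>
  obtain xs where xs: "(x \<longlongrightarrow> xs) at_top"
  proof (rule convergent_at_top_if_increments[of x])
    fix e :: real assume "e > 0"
    from eventually_small_tail[OF x'_int[OF order_refl] norm_ge_zero Cx this]
    obtain a where a: "0 \<le> a" "\<And>s t. a \<le> s \<Longrightarrow> s \<le> t \<Longrightarrow> integral {s..t} (\<lambda>t. norm (x' t)) \<le> e" by blast
    have "norm (x t - x s) \<le> e" if st: "a \<le> s" "s \<le> t" for s t
    proof -
      have s: "0 \<le> s" using a st by simp
      have "norm (x t - x s) \<le> integral {s..t} (\<lambda>t. norm (x' t))"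
        by (rule norm_increment_le_integral[OF primitive_inner[OF x_deriv s st(2)] x'_int[OF s]]) auto
      also have "\<dots> \<le> e" using a st by simp
      finally show ?thesis .
    qed
    then show "\<exists>a. \<forall>s\<ge>a. \<forall>t\<ge>s. norm (x t - x s) \<le> e" by blast
  qed
  have "(p \<longlongrightarrow> grad\<Phi> xs) at_top"
    unfolding p_def using grad_cont xs
    by (intro isCont_tendsto_compose[of xs grad\<Phi>]) (auto simp: continuous_on_eq_continuous_at)
  \<comment> \<open>The gradient converges along the trajectory while the integral of its norm stays
    bounded, as the weight is at least 1.\<close>
  then have "grad\<Phi> xs = 0"
  proof (rule limit_zero_if_integral_bounded[OF _ pWcont _ Cp])
    show "norm (p t) \<le> (1 + t) powr \<alpha> * norm (p t)" if "0 \<le> t" for t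
      using mult_right_mono[OF powr_ge_1[OF that] norm_ge_zero[of "p t"]] by simp
  qed
  then have "xs \<in> argmin_set \<Phi>"
    using convex_gradient_inequality[OF convex grad, of xs] by (simp add: argmin_set_def)
  with xs show ?thesis by blast
qed

end
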